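(* Consider the bandit problem and the OFUL algorithm (with parameters $\lambda,R_\Theta,R,\delta$) run with feature matrix $\bar U$, as described in the context, and let $\mathbf v^\circ\in\mathbb R^C$. Suppose $\|\mathbf v^\circ\|_2\le R_\Theta$, $\lambda\ge\max\{1,R_{\mathcal X}^2,1/(4R_\Theta^2)\}$, and for all $a\in\mathcal A$, $\|\bar{\mathbf u}_a\|_2\le R_{\mathcal X}$ and $|m_a|\le1$. If $$\|\mathbf m-\bar U\mathbf v^\circ\|_2<\min_{a\ne a^\star}\frac{\bar{\mathbf u}_{a^\star}^\top\mathbf v^\circ-\bar{\mathbf u}_a^\top\mathbf v^\circ}{2\,\alpha(\bar U)\,\|\bar{\mathbf u}_{a^\star}-\bar{\mathbf u}_a\|_2},$$ then with probability at least $1-\delta$, for all $T\ge0$, the regret $\mathfrak R_T=\sum_{t=1}^T(m_{a^\star}-m_{A_t})$ satisfies $$\mathfrak R_T\le8\rho'\sqrt{TC\log\Big(1+\frac{TR_{\mathcal X}^2}{\lambda C}\Big)}\left(\lambda^{1/2}R_\Theta+R\sqrt{2\log\frac1\delta+C\log\Big(1+\frac{TR_{\mathcal X}^2}{\lambda C}\Big)}\right),$$ where $\rho'=\max\Big\{1,\max_{a\ne a^\star}\frac{m_{a^\star}-m_a}{\bar{\mathbf u}_{a^\star}^\top\mathbf v^\circ-\bar{\mathbf u}_a^\top\mathbf v^\circ}\Big\}$.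
   Context: Bandit problem: finite action set $\mathcal A=\{1,\dots,A\}$ with distinct feature vectors $\bar{\mathbf u}_a\in\mathbb R^C$; $\bar U\in\mathbb R^{A\times C}$ is the matrix with rows $\bar{\mathbf u}_a^\top$. At time $t\geq 1$ the algorithm plays $A_t$ and observes $Y_t=m_{A_t}+\eta_t$, where $\eta_t$ is centered and $R$-sub-Gaussian conditionally on the past and $A_t$; $\mathbf m=(m_a)_{a\in\mathcal A}\in\mathbb R^A$ is the vector of mean rewards, which need not be linear in the features. There is a unique optimal action: $\arg\max_a m_a=\{a^\star\}$. OFUL (parameters $\lambda,R_\Theta,R>0$, $\delta\in(0,1)$): at time $t$ let $\bar{\mathbf U}_{1:t-1}=[\bar{\mathbf u}_{A_1}\cdots\bar{\mathbf u}_{A_{t-1}}]\in\mathbb R^{C\times(t-1)}$, $\mathbf Y_{1:t-1}=(Y_1,\dots,Y_{t-1})^\top$, $V_{t-1}=\lambda I+\sum_{s=1}^{t-1}\bar{\mathbf u}_{A_s}\bar{\mathbf u}_{A_s}^\top$, $\hat{\mathbf v}_{t-1}=V_{t-1}^{-1}\bar{\mathbf U}_{1:t-1}\mathbf Y_{1:t-1}$, $D_{t-1}=R\sqrt{2\log\big(\det(V_{t-1})^{1/2}\lambda^{-C/2}/\delta\big)}+\lambda^{1/2}R_\Theta$, $\mathcal C_{t-1}=\{\mathbf v\in\mathbb R^C:\|\mathbf v-\hat{\mathbf v}_{t-1}\|_{V_{t-1}}\le D_{t-1}\}$ with $\|x\|_V=\sqrt{x^\top Vx}$, and play $A_t\in\arg\max_{a\in\mathcal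 A}\max_{\mathbf v\in\mathcal C_{t-1}}\bar{\mathbf u}_a^\top\mathbf v$. For a matrix $\bar U\in\mathbb R^{A\times C}$, $\alpha(\bar U)=\max_J\|\mathbf A_J^{-1}\|_2$, where $\mathbf A=\begin{bmatrix}\bar U\\ I_C\end{bmatrix}\in\mathbb R^{(A+C)\times C}$, $\mathbf A_J$ is the $C\times C$ submatrix of rows indexed by $J$, and $J$ ranges over all size-$C$ sets of rows for which $\mathbf A_J$ is invertible. *)

theory Defs
  imports "HOL-Probability.Probability"
begin

definition stack_id :: "real^'c^'a \<Rightarrow> real^'c^('a + 'c)" where
  "stack_id U = (\<chi> i. case i of Inl a \<Rightarrow> U $ a | Inr c \<Rightarrow> axis c 1)"

definition row_submatrix :: "real^'c^'r \<Rightarrow> ('c \<Rightarrow> 'r) \<Rightarrow> real^'c^'c" where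
  "row_submatrix B \<sigma> = (\<chi> i. B $ \<sigma> i)"

text \<open>A square submatrix on a row set \<open>J\<close> is obtained from an enumeration \<open>\<sigma>\<close> of \<open>J\<close> by the
  column index type. All enumerations of \<open>J\<close> are admitted: they permute the rows, which leaves the
  spectral norm of the inverse unchanged. The spectral norm is the operator norm for the Euclidean
  norms. The maximum is over a finite set that contains the value for the identity block.\<close>

definition alpha :: "real^'c^'a \<Rightarrow> real" where
  "alpha U = Max {onorm (\<lambda>x. matrix_inv (row_submatrix (stack_id U) \<sigma>) *v x) | \<sigma> J.
      card J = CARD('c) \<and> bij_betw \<sigma> UNIV J \<and> invertible (row_submatrix (stack_id U) \<sigma>)}"

text \<open>The \<open>\<sigma>\<close>-algebra generated by \<open>A\<^sub>1, Y\<^sub>1, \<dots>, A\<^sub>t\<^sub>-\<^sub>1, Y\<^sub>t\<^sub>-\<^sub>1\<close> and \<open>A\<^sub>t\<close>.\<close>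

definition past_and_action ::
    "'w measure \<Rightarrow> (nat \<Rightarrow> 'w \<Rightarrow> 'a) \<Rightarrow> (nat \<Rightarrow> 'w \<Rightarrow> real) \<Rightarrow> nat \<Rightarrow> 'w measure" where
  "past_and_action M Act Y t =
     vimage_algebra (space M)
       (\<lambda>\<omega>. (\<lambda>s\<in>{1..<t}. (Act s \<omega>, Y s \<omega>), Act t \<omega>))
       (PiM {1..<t} (\<lambda>_. count_space UNIV \<Otimes>\<^sub>M borel) \<Otimes>\<^sub>M count_space UNIV)"

text \<open>The moment generating function is a nonnegative conditional expectation, so that the bound
  makes sense (and implies integrability) without a separate integrability assumption on it.\<close>

definition cond_centered_subgaussian ::
    "'w measure \<Rightarrow> 'w measure \<Rightarrow> real \<Rightarrow> ('w \<Rightarrow> real) \<Rightarrow> bool" where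
  "cond_centered_subgaussian M F R \<eta> \<longleftrightarrow>
     integrable M \<eta> \<and>
     (AE \<omega> in M. real_cond_exp M F \<eta> \<omega> = 0) \<and>
     (\<forall>x::real. AE \<omega> in M.
        nn_cond_exp M F (\<lambda>\<omega>. ennreal (exp (x * \<eta> \<omega>))) \<omega> \<le> ennreal (exp (x\<^sup>2 * R\<^sup>2 / 2)))"

text \<open>The quantities below are functions of one trajectory, given by the actions \<open>act s\<close> and the
  rewards \<open>y s\<close> for \<open>s \<ge> 1\<close>. The argument \<open>n\<close> is the number of completed rounds, so that the
  action of round \<open>t\<close> is chosen with \<open>n = t - 1\<close>.\<close>

definition oful_V :: "real^'c^'a \<Rightarrow> real \<Rightarrow> (nat \<Rightarrow> 'a) \<Rightarrow> nat \<Rightarrow> real^'c^'c" where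
  "oful_V U lam act n =
     lam *\<^sub>R mat 1 + (\<Sum>s=1..n. \<chi> i j. U $ act s $ i * U $ act s $ j)"

definition oful_estimate ::
    "real^'c^'a \<Rightarrow> real \<Rightarrow> (nat \<Rightarrow> 'a) \<Rightarrow> (nat \<Rightarrow> real) \<Rightarrow> nat \<Rightarrow> real^'c" where
  "oful_estimate U lam act y n =
     matrix_inv (oful_V U lam act n) *v (\<Sum>s=1..n. y s *\<^sub>R U $ act s)"

definition oful_radius ::
    "real^'c^'a \<Rightarrow> real \<Rightarrow> real \<Rightarrow> real \<Rightarrow> real \<Rightarrow> (nat \<Rightarrow> 'a) \<Rightarrow> nat \<Rightarrow> real" where
  "oful_radius U lam R_Theta R \<delta> act n =
     R * sqrt (2 * ln (sqrt (det (oful_V U lam act n)) * lam powr (- (real CARD('c) / 2)) / \<delta>))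
     + sqrt lam * R_Theta"

definition matrix_norm :: "real^'c^'c \<Rightarrow> real^'c \<Rightarrow> real" where
  "matrix_norm V x = sqrt (x \<bullet> (V *v x))"

definition oful_confset ::
    "real^'c^'a \<Rightarrow> real \<Rightarrow> real \<Rightarrow> real \<Rightarrow> real \<Rightarrow> (nat \<Rightarrow> 'a) \<Rightarrow> (nat \<Rightarrow> real) \<Rightarrow> nat \<Rightarrow> (real^'c) set"
  where
  "oful_confset U lam R_Theta R \<delta> act y n =
     {v. matrix_norm (oful_V U lam act n) (v - oful_estimate U lam act y n)
           \<le> oful_radius U lam R_Theta R \<delta> act n}"

text \<open>For positive parameters and \<open>\<delta> < 1\<close> the confidence set is compact and nonempty, hence the
  supremum is a maximum. Ties may be broken arbitrarily.\<close>

definition oful_plays ::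
    "real^'c^'a \<Rightarrow> real \<Rightarrow> real \<Rightarrow> real \<Rightarrow> real \<Rightarrow> (nat \<Rightarrow> 'a) \<Rightarrow> (nat \<Rightarrow> real) \<Rightarrow> bool" where
  "oful_plays U lam R_Theta R \<delta> act y \<longleftrightarrow>
     (\<forall>t\<ge>1. is_arg_max
        (\<lambda>a. SUP v \<in> oful_confset U lam R_Theta R \<delta> act y (t - 1). U $ a \<bullet> v)
        (\<lambda>_. True) (act t))"

definition regret :: "real^'a \<Rightarrow> 'a \<Rightarrow> (nat \<Rightarrow> 'a) \<Rightarrow> nat \<Rightarrow> real" where
  "regret m a_star act T = (\<Sum>t=1..T. m $ a_star - m $ act t)"

definition gap_ratio :: "real^'c^'a \<Rightarrow> real^'a \<Rightarrow> 'a \<Rightarrow> real^'c \<Rightarrow> real" where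
  "gap_ratio U m a_star v =
     Max (insert 1
       ((\<lambda>a. (m $ a_star - m $ a) / (U $ a_star \<bullet> v - U $ a \<bullet> v)) ` (- {a_star})))"

text \<open>The infimum is over a finite set, hence a minimum; it is taken in the extended reals so that
  it is \<open>\<infinity>\<close> when \<open>a_star\<close> is the only action.\<close>

definition misspecification_threshold :: "real^'c^'a \<Rightarrow> 'a \<Rightarrow> real^'c \<Rightarrow> ereal" where
  "misspecification_threshold U a_star v =
     (INF a \<in> - {a_star}.
        ereal ((U $ a_star \<bullet> v - U $ a \<bullet> v) / (2 * alpha U * norm (U $ a_star - U $ a))))"

end

theory Submission
  imports Defs
begin

text \<open>Write \<open>V\<close> for the regularised Gram matrix after \<open>n\<close> rounds and \<open>\<epsilon> = m - U v0\<close>. The ridge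
  regression solution for the noiseless rewards, \<open>v = v0 + V\<^sup>-\<^sup>1 (\<Sum>s. \<epsilon> (A\<^sub>s) u (A\<^sub>s))\<close>, is \<open>v0\<close> shifted by a
  weighted least squares solution for the matrix obtained by stacking \<open>U\<close> and the identity. Such a
  solution is a convex combination of solutions of square subsystems, so \<open>norm (v - v0) \<le> \<alpha>(U) norm \<epsilon>\<close>
  whatever the weights are. Under the assumption on \<open>\<epsilon>\<close> the vector \<open>v\<close> therefore keeps at least half of
  every gap of \<open>v0\<close>, although it varies with the history. The estimate of OFUL differs from \<open>v\<close>
  only by the noise and the regularisation bias, so the method of mixtures puts \<open>v\<close> into all
  confidence sets simultaneously with probability at least \<open>1 - \<delta>\<close>. On that event the optimistic
  choice bounds the gaps with respect to \<open>v\<close>, hence up to the factor \<open>2 \<rho>'\<close> the true gaps, by the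
  confidence widths, which are summed by the elliptical potential lemma.\<close>

section \<open>Determinants and positive definite matrices\<close>

text \<open>Gram-Schmidt without normalisation: row \<open>k\<close> is replaced by its component
  orthogonal to the rows already treated. Subtracting a combination of other rows keeps the
  determinant, and by Pythagoras the row cannot become longer.\<close>

lemma gram_schmidt_rows:
  fixes A :: "real^'n^'n"
  assumes "finite S"
  shows "\<exists>A'. det A' = det A \<and> (\<forall>i. i \<notin> S \<longrightarrow> A' $ i = A $ i) \<and> (\<forall>i. norm (A' $ i) \<le> norm (A $ i))
     \<and> pairwise (\<lambda>i j. orthogonal (A' $ i) (A' $ j)) S"
  using assms
proof induction
  case empty
  show ?case by (rule exI[of _ A]) auto
next
  case (insert k S)
  then obtain A' where A': "det A' = det A" "\<And>i. i \<notin> S \<Longrightarrow> A' $ i = A $ i"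
    "\<And>i. norm (A' $ i) \<le> norm (A $ i)" "pairwise (\<lambda>i j. orthogonal (A' $ i) (A' $ j)) S"
    by blast
  obtain y z where y: "y \<in> span ((\<lambda>i. A' $ i) ` S)"
    and z: "\<And>w. w \<in> span ((\<lambda>i. A' $ i) ` S) \<Longrightarrow> orthogonal z w" and k: "A' $ k = y + z"
    using orthogonal_subspace_decomp_exists by blast
  define A'' where "A'' = (\<chi> i. if i = k then row k A' + (- y) else row i A')"
  \<comment> \<open>Since \<open>k\<close> is not in \<open>S\<close>, the rows that span
    \<open>y\<close> are all different from row \<open>k\<close>, so this is an admissible row
    operation.\<close>
  have "- y \<in> vec.span {row j A' |j. j \<noteq> k}"
  proof -
    have "(\<lambda>i. A' $ i) ` S \<subseteq> {row j A' |j. j \<noteq> k}"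
      using insert.hyps(2) by (auto simp: row_def vec_nth_inverse)
    then have "- y \<in> span {row j A' |j. j \<noteq> k}"
      using y span_mono span_neg by blast
    then show ?thesis by (simp add: span_vec_eq)
  qed
  then have "det A'' = det A'" unfolding A''_def by (rule det_row_span)
  have rows: "A'' $ i = (if i = k then z else A' $ i)" for i
    by (auto simp: A''_def row_def k vec_eq_iff)
  have z_orth: "orthogonal z (A' $ i)" if "i \<in> S" for i
    using that by (intro z span_base) auto
  have "norm z \<le> norm (A $ k)"
  proof -
    have "orthogonal y z" using z[OF y] by (simp add: orthogonal_commute)
    then have "(norm (A' $ k))\<^sup>2 = (norm y)\<^sup>2 + (norm z)\<^sup>2"
      unfolding k by (rule norm_add_Pythagorean)
    then have "(norm z)\<^sup>2 \<le> (norm (A' $ k))\<^sup>2" by simp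
    then have "norm z \<le> norm (A' $ k)" by (rule power2_le_imp_le) simp
    then show ?thesis using A'(3)[of k] by linarith
  qed
  show ?case
  proof (intro exI[of _ A''] conjI allI impI)
    show "det A'' = det A" using \<open>det A'' = det A'\<close> A'(1) by simp
    show "A'' $ i = A $ i" if "i \<notin> insert k S" for i using that A'(2) rows by simp
    show "norm (A'' $ i) \<le> norm (A $ i)" for i using \<open>norm z \<le> _\<close> A'(3) rows by simp
    show "pairwise (\<lambda>i j. orthogonal (A'' $ i) (A'' $ j)) (insert k S)"
      using A'(4) insert.hyps(2) z_orth
      by (auto simp: pairwise_insert rows orthogonal_commute pairwise_def)
  qed
qed

text \<open>Once the rows are orthogonal, \<open>A' ** transpose A'\<close> is diagonal and carries
  the squared row norms, so its determinant is their product.\<close>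

theorem Hadamard_det_le:
  fixes A :: "real^'n^'n"
  shows "(det A)\<^sup>2 \<le> (\<Prod>i\<in>UNIV. (norm (A $ i))\<^sup>2)"
proof -
  obtain A' where A': "det A' = det A" "\<And>i. norm (A' $ i) \<le> norm (A $ i)"
     "pairwise (\<lambda>i j. orthogonal (A' $ i) (A' $ j)) UNIV"
    using gram_schmidt_rows[of UNIV A] by auto
  have nth: "(A' ** transpose A') $ i $ j = A' $ i \<bullet> A' $ j" for i j
    by (simp add: matrix_matrix_mult_def transpose_def inner_vec_def)
  have "(det A)\<^sup>2 = det (A' ** transpose A')"
    by (simp add: det_mul det_transpose power2_eq_square A'(1))
  also have "\<dots> = (\<Prod>i\<in>UNIV. (A' ** transpose A') $ i $ i)"
  proof (rule det_diagonal)
    show "(A' ** transpose A') $ i $ j = 0" if "i \<noteq> j" for i j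
      using A'(3) that unfolding nth pairwise_def orthogonal_def by blast
  qed
  also have "\<dots> \<le> (\<Prod>i\<in>UNIV. (norm (A $ i))\<^sup>2)"
    unfolding nth by (intro prod_mono) (auto simp: dot_square_norm A'(2) power_mono)
  finally show ?thesis .
qed

lemma matrix_inv_eqI:
  fixes A B :: "real^'n^'n"
  assumes "A ** B = mat 1"
  shows "matrix_inv A = B"
proof -
  have "B ** A = mat 1" using assms by (simp add: matrix_left_right_inverse)
  have "A ** matrix_inv A = mat 1 \<and> matrix_inv A ** A = mat 1"
    unfolding matrix_inv_def by (rule someI[of _ B]) (use assms \<open>B ** A = mat 1\<close> in blast)
  then have "B ** (A ** matrix_inv A) = B" by simp
  then show ?thesis by (simp add: matrix_mul_assoc \<open>B ** A = mat 1\<close>)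
qed

lemma
  fixes A :: "real^'n^'n"
  assumes "invertible A"
  shows matrix_inv_right: "A ** matrix_inv A = mat 1"
    and matrix_inv_left: "matrix_inv A ** A = mat 1"
  using assms matrix_inv_eqI unfolding invertible_def by blast+

section \<open>Rank-one matrices, their determinants, and norms weighted by a positive definite
  matrix\<close>

definition outer :: "real^'n \<Rightarrow> real^'n^'n" where
  "outer u = (\<chi> i j. u $ i * u $ j)"

lemma outer_mult_vector: "outer u *v x = (u \<bullet> x) *\<^sub>R u"
  by (simp add: outer_def matrix_vector_mult_def vec_eq_iff inner_vec_def sum_distrib_right
      sum_distrib_left mult_ac)

lemma outer_mult_outer: "outer u ** outer u = (norm u)\<^sup>2 *\<^sub>R outer u"
  by (simp add: outer_def matrix_matrix_mult_def vec_eq_iff power2_norm_eq_inner inner_vec_def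
      sum_distrib_right sum_distrib_left mult_ac)

lemma outer_congruence: "C ** outer w ** transpose C = outer (C *v w)"
proof -
  have "(\<Sum>k\<in>UNIV. (\<Sum>n\<in>UNIV. C $ i $ n * (w $ n * w $ k)) * C $ j $ k)
      = (\<Sum>n\<in>UNIV. C $ i $ n * w $ n) * (\<Sum>k\<in>UNIV. C $ j $ k * w $ k)" for i j
  proof -
    have "(\<Sum>n\<in>UNIV. C $ i $ n * (w $ n * w $ k)) * C $ j $ k
        = (\<Sum>n\<in>UNIV. C $ i $ n * w $ n) * (C $ j $ k * w $ k)" for k
      unfolding sum_distrib_right by (simp add: mult_ac)
    then show ?thesis by (simp only: sum_distrib_left)
  qed
  then show ?thesis
    by (simp add: outer_def matrix_matrix_mult_def transpose_def matrix_vector_mult_def vec_eq_iff)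
qed

lemma matrix_add_rdistrib: "(A + B) ** C = A ** C + B ** (C::real^'n^'m)"
  by (simp add: matrix_matrix_mult_def vec_eq_iff sum.distrib distrib_right)

text \<open>A rotation \<open>Q\<close> that takes \<open>w\<close> to a multiple of a coordinate
  axis makes the matrix diagonal with a single entry different from 1. Conjugation by
  \<open>Q\<close> preserves the determinant.\<close>

lemma det_one_plus_outer:
  fixes w :: "real^'n"
  shows "det (mat 1 + outer w) = 1 + (norm w)\<^sup>2"
proof -
  obtain k :: 'n where True by blast
  define e where "e = norm w *\<^sub>R axis k (1::real)"
  obtain f where f: "orthogonal_transformation f" "f w = e"
    using orthogonal_transformation_exists[of w e] by (auto simp: e_def)
  define Q where "Q = matrix f"
  have Qw: "Q *v w = e"
    using f by (simp add: Q_def matrix_works orthogonal_transformation_linear)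
  have Q: "Q ** transpose Q = mat 1"
    using f(1) by (simp add: Q_def orthogonal_transformation_matrix orthogonal_matrix_def)
  have *: "Q ** (mat 1 + outer w) ** transpose Q = mat 1 + outer e"
    by (simp add: outer_congruence Qw matrix_add_ldistrib matrix_add_rdistrib Q)
  have "det Q * det (transpose Q) = 1"
    by (metis Q det_I det_mul)
  then have "det (mat 1 + outer w) = det (Q ** (mat 1 + outer w) ** transpose Q)"
    unfolding det_mul by (simp add: mult.commute mult.left_commute)
  also have "\<dots> = (\<Prod>i\<in>UNIV. (mat 1 + outer e) $ i $ i)"
    unfolding * by (rule det_diagonal) (auto simp: e_def axis_def mat_def outer_def)
  also have "\<dots> = (\<Prod>i\<in>UNIV. if i = k then 1 + (norm w)\<^sup>2 else 1)"
    by (rule prod.cong) (auto simp: e_def axis_def mat_def outer_def power2_eq_square)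
  finally show ?thesis by (simp add: prod.If_cases)
qed

text \<open>A factorisation \<open>V = B\<^sup>T B\<close> serves as a certificate that \<open>V\<close> is symmetric positive definite.
  It is built by rank-one updates, because \<open>(1 + c w w\<^sup>T)\<^sup>2 = 1 + w w\<^sup>T\<close> for a suitable \<open>c\<close>.\<close>

definition spd_factor :: "real^'n^'n \<Rightarrow> real^'n^'n \<Rightarrow> bool" where
  "spd_factor V B \<longleftrightarrow> invertible B \<and> V = transpose B ** B"

text \<open>With \<open>V = transpose B ** B\<close> the inverse is
  \<open>matrix_inv B ** transpose (matrix_inv B)\<close>. Both weighted norms thus become Euclidean
  norms of transformed vectors, and no spectral theory or matrix square root is required.\<close>

lemma
  assumes "spd_factor V B"
  shows spd_factor_invertible: "invertible V"
    and spd_factor_det: "det V = (det B)\<^sup>2"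
    and spd_factor_det_pos: "det V > 0"
    and matrix_norm_factor: "matrix_norm V x = norm (B *v x)"
    and matrix_norm_inv_factor: "matrix_norm (matrix_inv V) x = norm (x v* matrix_inv B)"
proof -
  have B: "invertible B" and V: "V = transpose B ** B"
    using assms by (auto simp: spd_factor_def)
  show inv: "invertible V" unfolding V using B by (simp add: invertible_mult transpose_invertible)
  show det: "det V = (det B)\<^sup>2" by (simp add: V det_mul det_transpose power2_eq_square)
  have "det B \<noteq> 0" using B by (simp add: invertible_det_nz)
  then show "det V > 0" unfolding det by simp
  show "matrix_norm V x = norm (B *v x)"
    unfolding matrix_norm_def V norm_eq_sqrt_inner
    by (metis dot_lmul_matrix inner_commute matrix_vector_mul_assoc transpose_matrix_vector)
  have "transpose B ** B ** (matrix_inv B ** transpose (matrix_inv B))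
      = transpose B ** (B ** matrix_inv B) ** transpose (matrix_inv B)"
    by (simp add: matrix_mul_assoc)
  also have "\<dots> = transpose (matrix_inv B ** B)"
    by (simp add: matrix_inv_right[OF B] matrix_transpose_mul)
  finally have "V ** (matrix_inv B ** transpose (matrix_inv B)) = mat 1"
    by (simp add: matrix_inv_left[OF B] V transpose_mat)
  then have "matrix_inv V = matrix_inv B ** transpose (matrix_inv B)"
    by (rule matrix_inv_eqI)
  then show "matrix_norm (matrix_inv V) x = norm (x v* matrix_inv B)"
    unfolding matrix_norm_def norm_eq_sqrt_inner
    by (metis dot_lmul_matrix matrix_vector_mul_assoc transpose_matrix_vector)
qed

text \<open>Cauchy-Schwarz after inserting \<open>matrix_inv B ** B\<close> between the two
  vectors.\<close>

lemma inner_le_matrix_norms: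
  assumes "spd_factor V B"
  shows "u \<bullet> x \<le> matrix_norm (matrix_inv V) u * matrix_norm V x"
proof -
  have B: "invertible B" using assms by (auto simp: spd_factor_def)
  have "u \<bullet> x = (u v* matrix_inv B) \<bullet> (B *v x)"
    by (simp add: dot_lmul_matrix matrix_vector_mul_assoc matrix_inv_left[OF B])
  also have "\<dots> \<le> norm (u v* matrix_inv B) * norm (B *v x)" by (rule norm_cauchy_schwarz)
  finally show ?thesis
    by (simp add: matrix_norm_factor[OF assms] matrix_norm_inv_factor[OF assms])
qed

lemma matrix_norm_nonneg:
  assumes "spd_factor V B" shows "0 \<le> matrix_norm V x"
  by (simp add: matrix_norm_factor[OF assms])

lemma matrix_norm_inv_nonneg:
  assumes "spd_factor V B" shows "0 \<le> matrix_norm (matrix_inv V) x"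
  by (simp add: matrix_norm_inv_factor[OF assms])

lemma matrix_norm_scaleR:
  assumes "spd_factor V B" shows "matrix_norm V (c *\<^sub>R x) = \<bar>c\<bar> * matrix_norm V x"
  by (simp add: matrix_norm_factor[OF assms] matrix_vector_mult_scaleR)

lemma matrix_norm_inv_mult:
  assumes "spd_factor V B"
  shows "matrix_norm V (matrix_inv V *v x) = matrix_norm (matrix_inv V) x"
proof -
  have "V *v (matrix_inv V *v x) = x"
    by (simp add: matrix_vector_mul_assoc matrix_inv_right spd_factor_invertible[OF assms])
  then show ?thesis by (simp add: matrix_norm_def inner_commute)
qed

text \<open>For \<open>z = matrix_inv V *v u\<close>, the square of the left side is
  \<open>u \<bullet> z\<close>, at most \<open>norm u * norm z\<close>, while the lower bound on the
  quadratic form controls \<open>norm z\<close> by the left side itself. One factor then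
  cancels.\<close>

lemma matrix_norm_inv_le:
  assumes V: "spd_factor V B" and "lam > 0" and low: "\<And>x. lam * (norm x)\<^sup>2 \<le> x \<bullet> (V *v x)"
  shows "matrix_norm (matrix_inv V) u \<le> norm u / sqrt lam"
proof -
  define z where "z = matrix_inv V *v u"
  define q where "q = matrix_norm (matrix_inv V) u"
  have q: "q = matrix_norm V z" using matrix_norm_inv_mult[OF V] by (simp add: q_def z_def)
  have "q \<ge> 0" unfolding q by (rule matrix_norm_nonneg[OF V])
  have "sqrt lam * norm z \<le> q"
    using real_sqrt_le_mono[OF low[of z]] \<open>lam > 0\<close> by (simp add: q matrix_norm_def real_sqrt_mult)
  have "q\<^sup>2 = u \<bullet> z"
  proof -
    have "V *v z = u"
      by (simp add: z_def matrix_vector_mul_assoc matrix_inv_right spd_factor_invertible[OF V])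
    moreover have "0 \<le> z \<bullet> (V *v z)"
      using low[of z] \<open>lam > 0\<close> by (smt (verit) mult_nonneg_nonneg zero_le_power2)
    ultimately show ?thesis unfolding q matrix_norm_def by (simp add: inner_commute)
  qed
  also have "\<dots> \<le> norm u * norm z" by (rule norm_cauchy_schwarz)
  finally have "sqrt lam * q\<^sup>2 \<le> norm u * (sqrt lam * norm z)"
    using \<open>lam > 0\<close> by (simp add: mult.left_commute)
  also have "\<dots> \<le> norm u * q" using \<open>sqrt lam * norm z \<le> q\<close> by (simp add: mult_left_mono)
  finally have "q * (sqrt lam * q) \<le> q * norm u" by (simp add: power2_eq_square mult_ac)
  then have "sqrt lam * q \<le> norm u"
    using \<open>q \<ge> 0\<close> by (cases "q = 0") auto
  then show ?thesis using \<open>lam > 0\<close> by (simp add: q_def[symmetric] pos_le_divide_eq mult.commute)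
qed

lemma scaled_identity_mult_vector: "(c *\<^sub>R mat 1) *v (x::real^'n) = c *\<^sub>R x"
  by (simp add: scaleR_matrix_vector_assoc[symmetric])

lemma spd_factor_scaled_identity:
  assumes "c > 0"
  shows "spd_factor (c *\<^sub>R mat 1 :: real^'n^'n) (sqrt c *\<^sub>R mat 1)"
proof -
  have *: "(a *\<^sub>R mat 1) ** (b *\<^sub>R mat 1) = ((a * b) *\<^sub>R mat 1 :: real^'n^'n)" for a b
    by (simp add: matrix_scalar_ac scalar_matrix_assoc[symmetric])
  have t: "transpose (sqrt c *\<^sub>R mat 1) = (sqrt c *\<^sub>R mat 1 :: real^'n^'n)"
    by (auto simp: transpose_def mat_def vec_eq_iff)
  show ?thesis unfolding spd_factor_def invertible_def t
    using assms by (auto simp: * intro!: exI[of _ "inverse (sqrt c) *\<^sub>R mat 1"])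
qed

text \<open>Pulling the factor \<open>B\<close> out on both sides turns the update by
  \<open>u\<close> into the update of the identity by \<open>w\<close>, the image of
  \<open>u\<close> under the inverse transpose of \<open>B\<close>. The determinant formula is the
  matrix determinant lemma.\<close>

lemma
  fixes V B :: "real^'n^'n"
  assumes V: "spd_factor V B"
  shows spd_factor_add_outer: "\<exists>B'. spd_factor (V + outer u) B'"
    and det_add_outer: "det (V + outer u) = det V * (1 + (matrix_norm (matrix_inv V) u)\<^sup>2)"
proof -
  have B: "invertible B" and VB: "V = transpose B ** B"
    using assms by (auto simp: spd_factor_def)
  define w where "w = u v* matrix_inv B"
  have "transpose B *v w = u"
    unfolding w_def
    by (metis (no_types, lifting) B matrix_inv_left matrix_vector_mul_assoc matrix_vector_mul_lid
        transpose_matrix_vector matrix_transpose_mul transpose_mat)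
  then have "transpose B ** outer w ** B = outer u"
    using outer_congruence[of "transpose B" w] by (simp add: transpose_transpose)
  then have eq: "V + outer u = transpose B ** (mat 1 + outer w) ** B"
    by (simp add: VB matrix_add_ldistrib matrix_add_rdistrib)
  show "det (V + outer u) = det V * (1 + (matrix_norm (matrix_inv V) u)\<^sup>2)"
    unfolding eq matrix_norm_inv_factor[OF V]
    by (simp add: det_mul det_transpose spd_factor_det[OF V] det_one_plus_outer w_def power2_eq_square)
  define q where "q = (norm w)\<^sup>2"
  \<comment> \<open>A root of \<open>2 * c + q * c\<^sup>2 = 1\<close>, which makes
    \<open>E ** E = mat 1 + outer w\<close>. For \<open>q = 0\<close> the division yields 0, which
    is harmless because then \<open>outer w = 0\<close>.\<close>
  define c where "c = (sqrt (1 + q) - 1) / q"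
  have "q \<ge> 0" by (simp add: q_def)
  define E where "E = mat 1 + c *\<^sub>R outer w"
  have "(2 * c + c * c * q) *\<^sub>R outer w = outer w"
  proof (cases "q = 0")
    case True
    then have "outer w = 0" by (auto simp: q_def outer_def vec_eq_iff)
    then show ?thesis by simp
  next
    case False
    have "q * (2 * c + c * c * q) = (c * q + 1)\<^sup>2 - 1" by (simp add: power2_eq_square algebra_simps)
    also have "\<dots> = q" using False \<open>q \<ge> 0\<close> by (simp add: c_def)
    finally have "2 * c + c * c * q = 1" using False by simp
    then show ?thesis by simp
  qed
  moreover have "E ** E = mat 1 + (c *\<^sub>R outer w + c *\<^sub>R outer w + (c * c * q) *\<^sub>R outer w)"
    unfolding E_def
    by (simp add: matrix_add_ldistrib matrix_add_rdistrib matrix_scalar_ac scalar_matrix_assoc[symmetric]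
        outer_mult_outer q_def[symmetric] algebra_simps)
  moreover have "c *\<^sub>R outer w + c *\<^sub>R outer w + (c * c * q) *\<^sub>R outer w = (2 * c + c * c * q) *\<^sub>R outer w"
    by (simp add: scaleR_left_distrib[symmetric])
  ultimately have EE: "E ** E = mat 1 + outer w" by simp
  have tE: "transpose E = E"
    unfolding E_def by (simp add: transpose_def outer_def vec_eq_iff mat_def mult_ac)
  have "(det E)\<^sup>2 = 1 + q"
    by (metis EE det_mul det_one_plus_outer power2_eq_square q_def)
  then have "det E \<noteq> 0" using \<open>q \<ge> 0\<close> by auto
  then have "invertible (E ** B)"
    using B by (intro invertible_mult) (simp_all add: invertible_det_nz)
  moreover have "V + outer u = transpose (E ** B) ** (E ** B)"
    unfolding eq EE[symmetric] by (simp add: matrix_transpose_mul tE matrix_mul_assoc)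
  ultimately show "\<exists>B'. spd_factor (V + outer u) B'" unfolding spd_factor_def by blast
qed

text \<open>Hadamard's inequality, applied to the transposed factor, bounds \<open>det V\<close> by
  the product of the diagonal entries. The arithmetic-geometric mean inequality then bounds that
  product through the trace.\<close>

lemma ln_det_le_ln_trace:
  fixes V :: "real^'n^'n"
  assumes V: "spd_factor V B"
  shows "ln (det V) \<le> real CARD('n) * ln (trace V / real CARD('n))"
proof -
  define C where "C = transpose B"
  have CB: "invertible C" and VC: "V = C ** transpose C"
    using assms by (auto simp: spd_factor_def C_def transpose_invertible)
  have nth: "V $ i $ i = (norm (C $ i))\<^sup>2" for i
    unfolding VC power2_norm_eq_inner by (simp add: matrix_matrix_mult_def transpose_def inner_vec_def)
  have pos: "V $ i $ i > 0" for i
  proof -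
    have "C $ i \<noteq> 0"
    proof
      assume "C $ i = 0"
      then have "row i C = 0" by (simp add: row_def vec_eq_iff)
      then have "det C = 0" by (rule det_zero_row)
      then show False using CB by (simp add: invertible_det_nz)
    qed
    then show ?thesis unfolding nth by simp
  qed
  define c where "c = trace V / real CARD('n)"
  have "trace V > 0" unfolding trace_def by (intro sum_pos) (auto simp: pos)
  then have "c > 0" by (simp add: c_def)
  have "det V = (det C)\<^sup>2" by (simp add: VC det_mul det_transpose power2_eq_square)
  also have "\<dots> \<le> (\<Prod>i\<in>UNIV. V $ i $ i)" unfolding nth by (rule Hadamard_det_le)
  finally have "ln (det V) \<le> ln (\<Prod>i\<in>UNIV. V $ i $ i)"
    using spd_factor_det_pos[OF V] by (subst ln_le_cancel_iff) auto
  also have "\<dots> = (\<Sum>i\<in>UNIV. ln (V $ i $ i))"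
    using pos by (intro ln_prod) (simp_all add: less_imp_neq[THEN not_sym])
  \<comment> \<open>The tangent of \<open>ln\<close> at the mean \<open>c\<close> of the diagonal
    entries; the linear corrections sum to zero exactly because \<open>c\<close> is the
    mean.\<close>
  also have "\<dots> \<le> (\<Sum>i\<in>UNIV. ln c + (V $ i $ i / c - 1))"
  proof (intro sum_mono)
    fix i
    have "ln (V $ i $ i) - ln c = ln (V $ i $ i / c)"
      using pos[of i] \<open>c > 0\<close> by (simp add: ln_div)
    also have "\<dots> \<le> V $ i $ i / c - 1"
      using pos[of i] \<open>c > 0\<close> by (intro ln_le_minus_one) auto
    finally show "ln (V $ i $ i) \<le> ln c + (V $ i $ i / c - 1)" by simp
  qed
  also have "\<dots> = real CARD('n) * ln c + (trace V / c - real CARD('n))"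
    by (simp add: sum.distrib sum_subtractf trace_def sum_divide_distrib)
  also have "trace V / c = real CARD('n)"
    using \<open>trace V > 0\<close> by (simp add: c_def)
  finally show ?thesis by (simp add: c_def)
qed

section \<open>Cauchy-Binet formula and weighted least squares\<close>

text \<open>Each factor in the Leibniz formula is a sum over rows \<open>r\<close>. Multiplying out
  amounts to choosing a row \<open>\<sigma> i\<close> for every \<open>i\<close>, and for fixed
  \<open>\<sigma>\<close> the sum over permutations is a determinant in \<open>B\<close>
  alone.\<close>

lemma det_weighted_gram_expand:
  fixes A B :: "real^'c^'r"
  shows "det (\<chi> i j. \<Sum>r\<in>UNIV. d r * A $ r $ i * B $ r $ j) =
    (\<Sum>\<sigma>\<in>UNIV. (\<Prod>i\<in>UNIV. d (\<sigma> i)) * (\<Prod>i\<in>UNIV. A $ \<sigma> i $ i) * det (row_submatrix B \<sigma>))"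
proof -
  have "det (\<chi> i j. \<Sum>r\<in>UNIV. d r * A $ r $ i * B $ r $ j)
    = (\<Sum>p | p permutes UNIV. of_int (sign p) *
        (\<Sum>\<sigma>\<in>UNIV. \<Prod>i\<in>UNIV. d (\<sigma> i) * A $ \<sigma> i $ i * B $ \<sigma> i $ p i))"
    by (simp add: det_def prod_sum_PiE)
  also have "\<dots> = (\<Sum>\<sigma>\<in>UNIV. \<Sum>p | p permutes UNIV. of_int (sign p) *
        (\<Prod>i\<in>UNIV. d (\<sigma> i) * A $ \<sigma> i $ i * B $ \<sigma> i $ p i))"
    unfolding sum_distrib_left by (rule sum.swap)
  also have "\<dots> = (\<Sum>\<sigma>\<in>UNIV. (\<Prod>i\<in>UNIV. d (\<sigma> i)) * (\<Prod>i\<in>UNIV. A $ \<sigma> i $ i) * det (row_submatrix B \<sigma>))"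
    by (simp add: det_def row_submatrix_def prod.distrib sum_distrib_left mult_ac)
  finally show ?thesis .
qed

text \<open>The sum runs over functions instead of row sets: non-injective ones contribute 0 and
  every set of full size is counted once per enumeration, whence the factorial. Averaging the
  one-sided expansion over all reorderings of \<open>\<sigma>\<close> turns the product of entries
  of \<open>A\<close> into its determinant.\<close>

theorem Cauchy_Binet_functions:
  fixes A B :: "real^'c^'r"
  shows "fact CARD('c) * det (\<chi> i j. \<Sum>r\<in>UNIV. d r * A $ r $ i * B $ r $ j) =
    (\<Sum>\<sigma>\<in>UNIV. (\<Prod>i\<in>UNIV. d (\<sigma> i)) * det (row_submatrix A \<sigma>) * det (row_submatrix B \<sigma>))"
proof -
  let ?G = "det (\<chi> i j. \<Sum>r\<in>UNIV. d r * A $ r $ i * B $ r $ j)"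
  have perm: "?G = (\<Sum>\<sigma>\<in>UNIV. (\<Prod>i\<in>UNIV. d (\<sigma> i)) * det (row_submatrix B \<sigma>) *
      (of_int (sign p) * (\<Prod>i\<in>UNIV. A $ \<sigma> (p i) $ i)))" if p: "p permutes UNIV" for p
  proof -
    \<comment> \<open>Reindexing by \<open>\<sigma> \<circ> p\<close> leaves the product of weights
      alone and contributes \<open>sign p\<close> through the determinant of
      \<open>B\<close>.\<close>
    have bij: "bij_betw (\<lambda>\<sigma>. \<sigma> \<circ> p) UNIV (UNIV :: ('c \<Rightarrow> 'r) set)"
      by (rule bij_betwI[where g = "\<lambda>\<sigma>. \<sigma> \<circ> inv p"])
        (auto simp: comp_assoc permutes_inv_o[OF p])
    have d: "(\<Prod>i\<in>UNIV. d (\<sigma> (p i))) = (\<Prod>i\<in>UNIV. d (\<sigma> i))" for \<sigma> :: "'c \<Rightarrow> 'r"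
      using prod.permute[OF p, of "\<lambda>i. d (\<sigma> i)"] by (simp add: o_def)
    have B: "det (row_submatrix B (\<sigma> \<circ> p)) = of_int (sign p) * det (row_submatrix B \<sigma>)" for \<sigma>
      using det_permute_rows[OF p, of "row_submatrix B \<sigma>"] by (simp add: row_submatrix_def)
    show ?thesis
      unfolding det_weighted_gram_expand
      by (subst sum.reindex_bij_betw[OF bij, symmetric]) (simp add: d B mult_ac)
  qed
  have "fact CARD('c) * ?G = (\<Sum>p | p permutes (UNIV :: 'c set). ?G)"
    by (simp add: card_permutations)
  also have "\<dots> = (\<Sum>p | p permutes (UNIV :: 'c set). \<Sum>\<sigma>\<in>UNIV. (\<Prod>i\<in>UNIV. d (\<sigma> i)) * det (row_submatrix B \<sigma>) *
      (of_int (sign p) * (\<Prod>i\<in>UNIV. A $ \<sigma> (p i) $ i)))"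
    by (rule sum.cong[OF refl], rule perm) simp
  also have "\<dots> = (\<Sum>\<sigma>\<in>UNIV. \<Sum>p | p permutes (UNIV :: 'c set). (\<Prod>i\<in>UNIV. d (\<sigma> i)) * det (row_submatrix B \<sigma>) *
      (of_int (sign p) * (\<Prod>i\<in>UNIV. A $ \<sigma> (p i) $ i)))"
    by (rule sum.swap)
  also have "\<dots> = (\<Sum>\<sigma>\<in>UNIV. (\<Prod>i\<in>UNIV. d (\<sigma> i)) * det (row_submatrix B \<sigma>) *
      det (transpose (row_submatrix A \<sigma>)))"
    unfolding sum_distrib_left[symmetric] by (simp add: det_def transpose_def row_submatrix_def)
  finally show ?thesis by (simp add: det_transpose mult_ac)
qed

lemma invertible_row_submatrix_imp_inj:
  assumes "invertible (row_submatrix A \<sigma>)"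
  shows "inj \<sigma>"
proof (rule injI, rule ccontr)
  fix i j assume "\<sigma> i = \<sigma> j" "i \<noteq> j"
  then have "det (row_submatrix A \<sigma>) = 0"
    by (intro det_identical_rows[of i j]) (auto simp: row_def row_submatrix_def)
  then show False using assms by (simp add: invertible_det_nz)
qed

text \<open>By Cramer's rule and the Cauchy-Binet formula the weighted least squares solution is a convex
  combination of the solutions \<open>A\<^sub>\<sigma>\<^sup>-\<^sup>1 b\<^sub>\<sigma>\<close> of the square subsystems, with weights proportional to
  \<open>(\<Prod>i. d (\<sigma> i)) (det A\<^sub>\<sigma>)\<^sup>2\<close>.\<close>

lemma weighted_least_squares_norm_le:
  fixes A :: "real^'c^'r" and b :: "real^'r" and d :: "'r \<Rightarrow> real"
  defines "G \<equiv> \<chi> i j. \<Sum>r\<in>UNIV. d r * A $ r $ i * A $ r $ j"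
  assumes d: "\<And>r. d r \<ge> 0" and G: "det G > 0"
    and K: "\<And>\<sigma>. invertible (row_submatrix A \<sigma>) \<Longrightarrow> onorm (\<lambda>x. matrix_inv (row_submatrix A \<sigma>) *v x) \<le> K"
  shows "norm (matrix_inv G *v (\<chi> i. \<Sum>r\<in>UNIV. d r * A $ r $ i * b $ r)) \<le> K * norm b"
proof -
  define x where "x = matrix_inv G *v (\<chi> i. \<Sum>r\<in>UNIV. d r * A $ r $ i * b $ r)"
  define z where "z \<sigma> = matrix_inv (row_submatrix A \<sigma>) *v (\<chi> i. b $ \<sigma> i)" for \<sigma>
  define w where "w \<sigma> = (\<Prod>i\<in>UNIV. d (\<sigma> i)) * (det (row_submatrix A \<sigma>))\<^sup>2" for \<sigma> :: "'c \<Rightarrow> 'r"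
  define D where "D = fact CARD('c) * det G"
  have "D > 0" using G by (simp add: D_def)
  have "w \<sigma> \<ge> 0" for \<sigma> unfolding w_def by (intro mult_nonneg_nonneg prod_nonneg) (auto simp: d)
  have sum_w: "(\<Sum>\<sigma>\<in>UNIV. w \<sigma>) = D"
    unfolding D_def G_def w_def Cauchy_Binet_functions by (simp add: power2_eq_square mult_ac)
  have Gx: "G *v x = (\<chi> i. \<Sum>r\<in>UNIV. d r * A $ r $ i * b $ r)"
    using G by (simp add: x_def matrix_vector_mul_assoc matrix_inv_right invertible_det_nz)
  have comp: "D * x $ k = (\<Sum>\<sigma>\<in>UNIV. w \<sigma> * z \<sigma> $ k)" for k
  proof -
    \<comment> \<open>\<open>A\<close> with column \<open>k\<close> overwritten by \<open>b\<close>.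
      The numerator in Cramer's rule is then again a weighted product determinant, to which the
      Cauchy-Binet formula applies with the same weights.\<close>
    define B where "B = (\<chi> r j. if j = k then b $ r else A $ r $ j)"
    have "x $ k * det G = det (\<chi> i j. if j = k then (G *v x) $ i else G $ i $ j)"
      by (rule cramer_lemma[symmetric])
    also have "(\<chi> i j. if j = k then (G *v x) $ i else G $ i $ j)
        = (\<chi> i j. \<Sum>r\<in>UNIV. d r * A $ r $ i * B $ r $ j)"
      unfolding Gx by (auto simp: G_def B_def vec_eq_iff)
    finally have "D * x $ k = fact CARD('c) * det (\<chi> i j. \<Sum>r\<in>UNIV. d r * A $ r $ i * B $ r $ j)"
      by (simp add: D_def mult_ac)
    also have "\<dots> = (\<Sum>\<sigma>\<in>UNIV. (\<Prod>i\<in>UNIV. d (\<sigma> i)) * det (row_submatrix A \<sigma>) * det (row_submatrix B \<sigma>))"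
      by (rule Cauchy_Binet_functions)
    also have "\<dots> = (\<Sum>\<sigma>\<in>UNIV. w \<sigma> * z \<sigma> $ k)"
    proof (rule sum.cong[OF refl])
      fix \<sigma> :: "'c \<Rightarrow> 'r"
      show "(\<Prod>i\<in>UNIV. d (\<sigma> i)) * det (row_submatrix A \<sigma>) * det (row_submatrix B \<sigma>) = w \<sigma> * z \<sigma> $ k"
      proof (cases "det (row_submatrix A \<sigma>) = 0")
        case True
        then show ?thesis by (simp add: w_def)
      next
        case False
        then have "row_submatrix A \<sigma> *v z \<sigma> = (\<chi> i. b $ \<sigma> i)"
          by (simp add: z_def matrix_vector_mul_assoc matrix_inv_right invertible_det_nz)
        then have "row_submatrix B \<sigma> = (\<chi> i j. if j = k then (row_submatrix A \<sigma> *v z \<sigma>) $ i else row_submatrix A \<sigma> $ i $ j)"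
          by (auto simp: row_submatrix_def B_def vec_eq_iff)
        then have "det (row_submatrix B \<sigma>) = z \<sigma> $ k * det (row_submatrix A \<sigma>)"
          by (simp only: cramer_lemma)
        then show ?thesis by (simp add: w_def power2_eq_square mult_ac)
      qed
    qed
    finally show ?thesis .
  qed
  then have "D *\<^sub>R x = (\<Sum>\<sigma>\<in>UNIV. w \<sigma> *\<^sub>R z \<sigma>)"
    by (simp add: vec_eq_iff)
  then have "D * norm x = norm (\<Sum>\<sigma>\<in>UNIV. w \<sigma> *\<^sub>R z \<sigma>)"
    using \<open>D > 0\<close> by (metis abs_of_pos norm_scaleR)
  also have "\<dots> \<le> (\<Sum>\<sigma>\<in>UNIV. w \<sigma> * (K * norm b))"
  proof (rule sum_norm_le)
    fix \<sigma> :: "'c \<Rightarrow> 'r"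
    show "norm (w \<sigma> *\<^sub>R z \<sigma>) \<le> w \<sigma> * (K * norm b)"
    proof (cases "invertible (row_submatrix A \<sigma>)")
      \<comment> \<open>\<open>z \<sigma>\<close> is meaningless for a singular subsystem, but its
        weight vanishes.\<close>
      case False
      then show ?thesis by (simp add: w_def invertible_det_nz)
    next
      case True
      \<comment> \<open>Injectivity is essential here: it ensures that no entry of \<open>b\<close>
        is counted twice in the restricted vector.\<close>
      have "inj \<sigma>" by (rule invertible_row_submatrix_imp_inj[OF True])
      have "(\<Sum>i\<in>UNIV. (b $ \<sigma> i)\<^sup>2) = (\<Sum>r\<in>range \<sigma>. (b $ r)\<^sup>2)"
        using \<open>inj \<sigma>\<close> by (simp add: sum.reindex)
      also have "\<dots> \<le> (\<Sum>r\<in>UNIV. (b $ r)\<^sup>2)" by (rule sum_mono2) auto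
      finally have b: "norm (\<chi> i. b $ \<sigma> i) \<le> norm b"
        by (simp add: norm_vec_def L2_set_def)
      have bl: "bounded_linear (\<lambda>x. matrix_inv (row_submatrix A \<sigma>) *v x)"
        by (rule matrix_vector_mul_bounded_linear)
      have "norm (z \<sigma>) \<le> onorm (\<lambda>x. matrix_inv (row_submatrix A \<sigma>) *v x) * norm (\<chi> i. b $ \<sigma> i)"
        unfolding z_def by (rule onorm[OF bl])
      also have "\<dots> \<le> K * norm b"
        using onorm_pos_le[OF bl] b K[OF True] by (intro mult_mono) auto
      finally show ?thesis using \<open>w \<sigma> \<ge> 0\<close> by (simp add: mult_left_mono)
    qed
  qed
  also have "\<dots> = D * (K * norm b)" by (simp add: sum_distrib_right[symmetric] sum_w)
  finally show ?thesis using \<open>D > 0\<close> unfolding x_def by simp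
qed

lemma finite_alpha_set:
  fixes U :: "real^'c^'a"
  shows "finite {onorm (\<lambda>x. matrix_inv (row_submatrix (stack_id U) \<sigma>) *v x) | \<sigma> J.
      card J = CARD('c) \<and> bij_betw \<sigma> UNIV J \<and> invertible (row_submatrix (stack_id U) \<sigma>)}"
  by (rule finite_subset[of _ "range (\<lambda>\<sigma>. onorm (\<lambda>x. matrix_inv (row_submatrix (stack_id U) \<sigma>) *v x))"]) auto

text \<open>An invertible selection of rows has no repetitions, so it enumerates a row set of the
  size required in \<open>alpha\<close>.\<close>

lemma onorm_le_alpha:
  fixes U :: "real^'c^'a" and \<sigma> :: "'c \<Rightarrow> 'a + 'c"
  assumes "invertible (row_submatrix (stack_id U) \<sigma>)"
  shows "onorm (\<lambda>x. matrix_inv (row_submatrix (stack_id U) \<sigma>) *v x) \<le> alpha U"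
proof -
  have "inj \<sigma>" by (rule invertible_row_submatrix_imp_inj[OF assms])
  then have "card (range \<sigma>) = CARD('c) \<and> bij_betw \<sigma> UNIV (range \<sigma>)"
    by (simp add: card_image bij_betw_def)
  with assms show ?thesis unfolding alpha_def by (intro Max_ge[OF finite_alpha_set]) blast
qed

text \<open>The identity block of the stacked matrix contributes operator norm 1. Positivity is used
  when the misspecification threshold is multiplied out.\<close>

lemma alpha_pos:
  fixes U :: "real^'c^'a"
  shows "alpha U > 0"
proof -
  have *: "row_submatrix (stack_id U) Inr = mat 1"
    by (auto simp: row_submatrix_def stack_id_def vec_eq_iff mat_def axis_def)
  moreover have "matrix_inv (mat 1) = (mat 1 :: real^'c^'c)" by (rule matrix_inv_eqI) simp
  moreover have "invertible (mat 1 :: real^'c^'c)" by (simp add: invertible_det_nz)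
  ultimately show ?thesis using onorm_le_alpha[of U Inr] onorm_id[where 'a="real^'c"] by simp
qed

section \<open>Gaussian integrals\<close>

lemma borel_measurable_matrix_vector_mult [measurable]:
  "(\<lambda>x. B *v x :: real^'n) \<in> borel_measurable borel"
  by (intro borel_measurable_continuous_onI linear_continuous_on linear_linear[THEN iffD2]) simp

lemma Basis_cart: "(Basis :: (real^'n) set) = range (\<lambda>i. axis i 1)"
  by (auto simp: Basis_vec_def)

lemma prod_Basis_cart: "(\<Prod>b\<in>(Basis :: (real^'n) set). g b) = (\<Prod>i\<in>UNIV. g (axis i 1))"
  unfolding Basis_cart by (subst prod.reindex) (auto simp: inj_on_def axis_eq_axis)

lemma sum_Basis_cart: "(\<Sum>b\<in>(Basis :: (real^'n) set). g b) = (\<Sum>i\<in>UNIV. g (axis i 1))"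
  unfolding Basis_cart by (subst sum.reindex) (auto simp: inj_on_def axis_eq_axis)

text \<open>Fubini along the direction \<open>i\<close>: as \<open>a\<close> is orthogonal to
  \<open>i\<close>, the shear acts on each line parallel to \<open>i\<close> as a translation, which
  preserves the one-dimensional integral.\<close>

lemma nn_integral_lborel_shear:
  fixes f :: "'a::euclidean_space \<Rightarrow> ennreal"
  assumes i: "i \<in> Basis" and a: "a \<bullet> i = 0" and [measurable]: "f \<in> borel_measurable borel"
  shows "(\<integral>\<^sup>+ x. f (x + (a \<bullet> x) *\<^sub>R i) \<partial>lborel) = (\<integral>\<^sup>+ x. f x \<partial>lborel)"
proof -
  interpret product_sigma_finite "\<lambda>_ :: 'a. lborel :: real measure" ..
  let ?J = "Basis - {i} :: 'a set" and ?P = "\<lambda>I. PiM I (\<lambda>_ :: 'a. lborel :: real measure)"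
  define S where "S \<omega> = (\<Sum>b\<in>?J. \<omega> b *\<^sub>R b)" for \<omega> :: "'a \<Rightarrow> real"
  have ins: "Basis = insert i ?J" using i by auto
  have upd: "(\<Sum>b\<in>Basis. fun_upd \<omega> i y b *\<^sub>R b) = S \<omega> + y *\<^sub>R i" for \<omega> y
    unfolding S_def by (subst ins, subst sum.insert) (auto intro!: sum.cong)
  have split: "(\<integral>\<^sup>+ x. g x \<partial>lborel) = (\<integral>\<^sup>+ \<omega>. (\<integral>\<^sup>+ y. g (S \<omega> + y *\<^sub>R i) \<partial>lborel) \<partial>?P ?J)"
    if [measurable]: "g \<in> borel_measurable borel" for g
  proof -
    have "(\<integral>\<^sup>+ x. g x \<partial>lborel) = (\<integral>\<^sup>+ \<omega>. g (\<Sum>b\<in>Basis. \<omega> b *\<^sub>R b) \<partial>?P (insert i ?J))"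
      unfolding lborel_def[where 'a='a] ins[symmetric] lborel_eq_real
      by (subst nn_integral_distr) simp_all
    also have "\<dots> = (\<integral>\<^sup>+ \<omega>. (\<integral>\<^sup>+ y. g (\<Sum>b\<in>Basis. fun_upd \<omega> i y b *\<^sub>R b) \<partial>lborel) \<partial>?P ?J)"
      by (subst product_nn_integral_insert) (simp_all add: insert_absorb[OF i])
    also have "\<dots> = (\<integral>\<^sup>+ \<omega>. (\<integral>\<^sup>+ y. g (S \<omega> + y *\<^sub>R i) \<partial>lborel) \<partial>?P ?J)"
      unfolding upd ..
    finally show ?thesis .
  qed
  have inner: "(\<integral>\<^sup>+ y. f (S \<omega> + y *\<^sub>R i + (a \<bullet> (S \<omega> + y *\<^sub>R i)) *\<^sub>R i) \<partial>lborel) = (\<integral>\<^sup>+ y. f (S \<omega> + y *\<^sub>R i) \<partial>lborel)" for \<omega>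
  proof -
    have eq: "S \<omega> + y *\<^sub>R i + (a \<bullet> (S \<omega> + y *\<^sub>R i)) *\<^sub>R i = S \<omega> + (a \<bullet> S \<omega> + 1 * y) *\<^sub>R i" for y
      by (simp add: a inner_right_distrib scaleR_left_distrib)
    show ?thesis unfolding eq
      by (subst (2) nn_integral_real_affine[where c = 1 and t = "a \<bullet> S \<omega>"]) simp_all
  qed
  show ?thesis by (subst (1 2) split) (simp_all add: inner)
qed

text \<open>It suffices to compare the measures of boxes, and the preimage of a box is the box with
  permuted sides.\<close>

lemma lborel_permute_coordinates:
  assumes p: "p permutes UNIV"
  shows "distr lborel borel (\<lambda>x. \<chi> i. x $ p i) = (lborel :: (real^'n) measure)"
proof (rule lborel_eqI[symmetric])
  fix l u :: "real^'n"
  assume "\<And>b. b \<in> Basis \<Longrightarrow> l \<bullet> b \<le> u \<bullet> b"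
  then have le: "l $ i \<le> u $ i" for i
    using axis_in_Basis_iff[of i "1::real"] by (metis Basis_real_def cart_eq_inner_axis singletonI)
  have [measurable]: "(\<lambda>x :: real^'n. \<chi> i. x $ p i) \<in> borel_measurable borel"
    by (intro borel_measurable_continuous_onI continuous_intros)
  have inv: "p (inv p i) = i" "inv p (p i) = i" for i
    using p by (simp_all add: permutes_inverses)
  have vimage: "(\<lambda>x. \<chi> i. x $ p i) -` box l u = box (\<chi> i. l $ inv p i) (\<chi> i. u $ inv p i)"
    unfolding set_eq_iff vimage_def mem_Collect_eq mem_box_cart vec_lambda_beta by (metis inv)
  have "emeasure lborel (box (\<chi> i. l $ inv p i) (\<chi> i. u $ inv p i)) = (\<Prod>i\<in>UNIV. (u - l) $ inv p i)"
    using le by (subst emeasure_lborel_box)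
      (simp_all only: prod_Basis_cart, auto simp: inner_axis Basis_cart)
  also have "(\<Prod>i\<in>UNIV. (u - l) $ inv p i) = (\<Prod>i\<in>UNIV. (u - l) $ i)"
    using prod.permute[OF permutes_inv[OF p], of "\<lambda>i. (u - l) $ i"] by (simp add: o_def)
  finally show "emeasure (distr lborel borel (\<lambda>x. \<chi> i. x $ p i)) (box l u) = (\<Prod>b\<in>Basis. (u - l) \<bullet> b)"
    by (simp add: emeasure_distr vimage prod_Basis_cart inner_axis)
qed simp

text \<open>The change of variables theorems of HOL-Analysis require a well-ordered index type.\<close>

lemma nn_integral_lborel_linear:
  fixes A :: "real^'n^'n"
  assumes "det A \<noteq> 0" and "f \<in> borel_measurable borel"
  shows "(\<integral>\<^sup>+ y. f y \<partial>lborel) = ennreal \<bar>det A\<bar> * (\<integral>\<^sup>+ x. f (A *v x) \<partial>lborel)"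
proof -
  define P where "P A \<longleftrightarrow> (\<forall>f \<in> borel_measurable borel. det A \<noteq> 0 \<longrightarrow>
    (\<integral>\<^sup>+ y. f y \<partial>lborel) = ennreal \<bar>det A\<bar> * (\<integral>\<^sup>+ x. f (A *v x) \<partial>lborel))" for A :: "real^'n^'n"
  have "P A"
  \<comment> \<open>The cases are products, matrices with a zero row (vacuous, the determinant
    vanishes), diagonal matrices, coordinate swaps and shears.\<close>
  proof (rule induct_matrix_elementary_alt)
    fix A B assume A: "P A" and B: "P B"
    show "P (A ** B)" unfolding P_def
    proof (intro ballI impI)
      fix f :: "real^'n \<Rightarrow> ennreal" assume [measurable]: "f \<in> borel_measurable borel" and d: "det (A ** B) \<noteq> 0"
      have "(\<integral>\<^sup>+ y. f y \<partial>lborel) = ennreal \<bar>det A\<bar> * (\<integral>\<^sup>+ x. f (A *v x) \<partial>lborel)"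
        using A[unfolded P_def, rule_format, of f] d unfolding det_mul by simp
      also have "(\<integral>\<^sup>+ x. f (A *v x) \<partial>lborel) = ennreal \<bar>det B\<bar> * (\<integral>\<^sup>+ x. f (A *v (B *v x)) \<partial>lborel)"
        using B[unfolded P_def, rule_format, of "\<lambda>x. f (A *v x)"] d unfolding det_mul by simp
      finally show "(\<integral>\<^sup>+ y. f y \<partial>lborel) = ennreal \<bar>det (A ** B)\<bar> * (\<integral>\<^sup>+ x. f (A ** B *v x) \<partial>lborel)"
        by (simp add: det_mul abs_mult ennreal_mult' matrix_vector_mul_assoc mult.assoc)
    qed
  next
    fix A :: "real^'n^'n" and i assume "row i A = 0"
    then show "P A" by (simp add: P_def det_zero_row)
  next
    fix A :: "real^'n^'n" assume diag: "\<And>i j. i \<noteq> j \<Longrightarrow> A $ i $ j = 0"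
    have det: "det A = (\<Prod>i\<in>UNIV. A $ i $ i)" by (rule det_diagonal[OF diag])
    show "P A" unfolding P_def
    proof (intro ballI impI)
      fix f :: "real^'n \<Rightarrow> ennreal" assume [measurable]: "f \<in> borel_measurable borel" and d: "det A \<noteq> 0"
      define c where "c b = (A *v b) \<bullet> b" for b :: "real^'n"
      have c: "c (axis i 1) = A $ i $ i" for i
        by (simp add: c_def inner_axis matrix_vector_mul_component inner_axis)
      have Ax: "0 + (\<Sum>j\<in>Basis. (c j * (x \<bullet> j)) *\<^sub>R j) = A *v x" for x
      proof -
        have "(A *v x) $ i = A $ i $ i * x $ i" for i
          unfolding matrix_vector_mult_def using sum.remove[of UNIV i "\<lambda>j. A $ i $ j * x $ j"]
          by (simp add: diag)
        then show ?thesis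
          by (simp add: sum_Basis_cart c inner_axis vec_eq_iff)
            (simp add: axis_def if_distrib cong: if_cong)
      qed
      have nz: "c j \<noteq> 0" if "j \<in> Basis" for j
        using that d by (auto simp: det Basis_cart c)
      have "lborel = density (distr lborel borel (\<lambda>x. A *v x)) (\<lambda>_. ennreal (\<Prod>j\<in>Basis. \<bar>c j\<bar>))"
        by (rule lborel_affine_euclidean[of c 0, unfolded Ax, OF nz])
      also have "(\<Prod>j\<in>Basis. \<bar>c j\<bar>) = \<bar>det A\<bar>"
        by (simp add: prod_Basis_cart c det abs_prod)
      finally have eq: "lborel = density (distr lborel borel (\<lambda>x. A *v x)) (\<lambda>_. ennreal \<bar>det A\<bar>)" .
      show "(\<integral>\<^sup>+ y. f y \<partial>lborel) = ennreal \<bar>det A\<bar> * (\<integral>\<^sup>+ x. f (A *v x) \<partial>lborel)"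
        by (subst eq) (simp add: nn_integral_density nn_integral_distr nn_integral_cmult)
    qed
  next
    fix m n :: 'n assume "m \<noteq> n"
    let ?p = "Transposition.transpose m n"
    let ?A = "(\<chi> i j. mat 1 $ i $ ?p j) :: real^'n^'n"
    have p: "?p permutes UNIV" by (rule permutes_swap_id) auto
    have mult: "?A *v x = (\<chi> i. x $ ?p i)" for x
    proof -
      have "(\<Sum>j\<in>UNIV. (if i = ?p j then 1 else 0) * x $ j) = (\<Sum>j\<in>UNIV. if j = ?p i then x $ j else 0)" for i
        by (rule sum.cong) auto
      then show ?thesis by (simp add: matrix_vector_mult_def mat_def vec_eq_iff)
    qed
    have det: "\<bar>det ?A\<bar> = 1"
      using \<open>m \<noteq> n\<close> by (subst det_permute_columns[OF p]) (simp add: sign_swap_id)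
    have [measurable]: "(\<lambda>x :: real^'n. \<chi> i. x $ ?p i) \<in> borel_measurable borel"
      by (intro borel_measurable_continuous_onI continuous_intros)
    have pres: "(\<integral>\<^sup>+ y. f y \<partial>lborel) = (\<integral>\<^sup>+ x. f (\<chi> i. x $ ?p i) \<partial>lborel)"
      if [measurable]: "f \<in> borel_measurable borel" for f :: "real^'n \<Rightarrow> ennreal"
      by (subst lborel_permute_coordinates[OF p, symmetric]) (simp add: nn_integral_distr)
    show "P ?A" unfolding P_def det mult
      by (intro ballI impI) (simp only: ennreal_1 mult_1, rule pres)
  next
    fix m n :: 'n assume "m \<noteq> n"
    let ?A = "(\<chi> i j. of_bool (i = m \<and> j = n \<or> i = j)) :: real^'n^'n"
    have mult: "?A *v x = x + (axis n 1 \<bullet> x) *\<^sub>R axis m 1" for x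
    proof -
      have "(\<Sum>j\<in>UNIV. of_bool (i = m \<and> j = n \<or> i = j) * x $ j)
          = (\<Sum>j\<in>UNIV. (if j = i then x $ j else 0) + (if j = n then of_bool (i = m) * x $ j else 0))" for i
        using \<open>m \<noteq> n\<close> by (intro sum.cong) auto
      then show ?thesis
        by (simp add: matrix_vector_mult_def vec_eq_iff sum.distrib inner_axis')
          (auto simp: axis_def)
    qed
    have "?A = (\<chi> k. if k = m then row m (mat 1) + 1 *s row n (mat 1) else row k (mat 1))"
      using \<open>m \<noteq> n\<close> by (auto simp: vec_eq_iff row_def mat_def)
    then have det: "det ?A = 1"
      using det_row_operation[OF \<open>m \<noteq> n\<close>, where c = 1 and A = "mat 1 :: real^'n^'n"] by simp
    have "axis n (1::real) \<bullet> axis m 1 = 0" using \<open>m \<noteq> n\<close> by (simp add: inner_axis_axis)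
    then show "P ?A" unfolding P_def det mult
      by (simp add: nn_integral_lborel_shear)
  qed
  then show ?thesis using assms unfolding P_def by blast
qed

lemma nn_integral_lborel_affine:
  fixes B :: "real^'n^'n"
  assumes B: "invertible B" and [measurable]: "f \<in> borel_measurable borel"
  shows "(\<integral>\<^sup>+ y. f y \<partial>lborel) = ennreal \<bar>det B\<bar> * (\<integral>\<^sup>+ x. f (B *v x - w) \<partial>lborel)"
proof -
  have "(\<integral>\<^sup>+ y. f y \<partial>lborel) = (\<integral>\<^sup>+ y. f y \<partial>distr lborel borel ((+) (- w)))"
    by (simp add: lborel_distr_plus)
  also have "\<dots> = (\<integral>\<^sup>+ y. f (y - w) \<partial>lborel)"
    by (subst nn_integral_distr) auto
  also have "\<dots> = ennreal \<bar>det B\<bar> * (\<integral>\<^sup>+ x. f (B *v x - w) \<partial>lborel)"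
    using B by (intro nn_integral_lborel_linear) (simp_all add: invertible_det_nz)
  finally show ?thesis .
qed

section \<open>Gaussian densities and the mixture integral\<close>

definition std_gaussian :: "real^'n \<Rightarrow> real" where
  "std_gaussian y = (1 / sqrt (2 * pi)) ^ CARD('n) * exp (- (norm y)\<^sup>2 / 2)"

lemma std_gaussian_nonneg: "std_gaussian y \<ge> 0"
  by (simp add: std_gaussian_def)

lemma borel_measurable_std_gaussian [measurable]: "std_gaussian \<in> borel_measurable borel"
  unfolding std_gaussian_def[abs_def] by measurable

lemma nn_integral_std_gaussian: "(\<integral>\<^sup>+ y. ennreal (std_gaussian (y :: real^'n)) \<partial>lborel) = 1"
proof -
  have eq: "std_gaussian y = (\<Prod>b\<in>Basis. std_normal_density (y \<bullet> b))" for y :: "real^'n"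
    unfolding std_normal_density_def prod.distrib std_gaussian_def
    by (simp add: exp_sum[symmetric] sum_negf sum_divide_distrib[symmetric]
        power2_norm_eq_inner euclidean_inner[of y y])
      (simp add: power2_eq_square)
  have 1: "(\<integral>\<^sup>+ x. ennreal (std_normal_density x) \<partial>lborel) = 1"
    by (subst nn_integral_eq_integral) auto
  show ?thesis
    unfolding eq
    by (subst prod_ennreal[symmetric], simp, subst nn_integral_lborel_prod) (auto simp: 1)
qed

text \<open>The centred normal law with covariance \<open>1 / lam\<close> times the identity, as a
  rescaled standard density. Its exponent supplies the regularisation term of \<open>oful_V\<close>
  when the exponential process is averaged.\<close>

definition gaussian_prior :: "real \<Rightarrow> (real^'n) measure" where
  "gaussian_prior lam = density lborel
     (\<lambda>x. ennreal (sqrt lam ^ CARD('n) * std_gaussian (sqrt lam *\<^sub>R x)))"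

lemma sets_gaussian_prior [measurable_cong, simp]: "sets (gaussian_prior lam) = sets borel"
  by (simp add: gaussian_prior_def)

text \<open>Completing the square. The term \<open>lam * (norm x)\<^sup>2\<close> subtracted from
  the form of \<open>V\<close> is restored by the prior, so the integrand is a constant times a
  Gaussian with precision matrix \<open>V\<close>, whose mass produces the determinant.\<close>

lemma gaussian_mixture:
  fixes V B :: "real^'n^'n"
  assumes V: "spd_factor V B" and "lam > 0"
  shows "(\<integral>\<^sup>+ x. ennreal (exp (x \<bullet> s - (x \<bullet> (V *v x) - lam * (norm x)\<^sup>2) / 2)) \<partial>gaussian_prior lam)
    = ennreal (sqrt lam ^ CARD('n) / sqrt (det V) * exp ((matrix_norm (matrix_inv V) s)\<^sup>2 / 2))"
proof -
  have B: "invertible B" using V by (simp add: spd_factor_def)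
  define w where "w = s v* matrix_inv B"
  define k where "k = sqrt lam ^ CARD('n) * exp ((norm w)\<^sup>2 / 2)"
  have "k > 0" using \<open>lam > 0\<close> by (simp add: k_def)
  have detV: "sqrt (det V) = \<bar>det B\<bar>" by (simp add: spd_factor_det[OF V])
  have "det B \<noteq> 0" using B by (simp add: invertible_det_nz)
  have pt: "sqrt lam ^ CARD('n) * std_gaussian (sqrt lam *\<^sub>R x) *
      exp (x \<bullet> s - (x \<bullet> (V *v x) - lam * (norm x)\<^sup>2) / 2) = k * std_gaussian (B *v x - w)" for x
  proof -
    have s: "x \<bullet> s = w \<bullet> (B *v x)"
      unfolding w_def dot_lmul_matrix
      by (simp add: matrix_vector_mul_assoc matrix_inv_left[OF B] inner_commute)
    have "x \<bullet> (V *v x) = (norm (B *v x))\<^sup>2"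
      using matrix_norm_factor[OF V, of x] by (simp add: matrix_norm_def norm_eq_sqrt_inner)
    then have "- (norm (sqrt lam *\<^sub>R x))\<^sup>2 / 2 + (x \<bullet> s - (x \<bullet> (V *v x) - lam * (norm x)\<^sup>2) / 2)
       = (norm w)\<^sup>2 / 2 + - (norm (B *v x - w))\<^sup>2 / 2"
      using \<open>lam > 0\<close>
      by (simp add: power_mult_distrib s[unfolded inner_commute[of x s]] power2_norm_eq_inner inner_diff inner_commute field_simps)
    then have "exp (- (norm (sqrt lam *\<^sub>R x))\<^sup>2 / 2) * exp (x \<bullet> s - (x \<bullet> (V *v x) - lam * (norm x)\<^sup>2) / 2)
      = exp ((norm w)\<^sup>2 / 2) * exp (- (norm (B *v x - w))\<^sup>2 / 2)"
      by (simp only: exp_add[symmetric])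
    then show ?thesis unfolding std_gaussian_def k_def by (simp add: mult.assoc mult.left_commute)
  qed
  have "(\<integral>\<^sup>+ x. ennreal (exp (x \<bullet> s - (x \<bullet> (V *v x) - lam * (norm x)\<^sup>2) / 2)) \<partial>gaussian_prior lam)
     = (\<integral>\<^sup>+ x. ennreal k * ennreal (std_gaussian (B *v x - w)) \<partial>lborel)"
    unfolding gaussian_prior_def
    using \<open>lam > 0\<close> \<open>k > 0\<close>
    by (subst nn_integral_density)
       (simp_all add: ennreal_mult'[symmetric] std_gaussian_nonneg pt)
  also have "\<dots> = ennreal k * (\<integral>\<^sup>+ x. ennreal (std_gaussian (B *v x - w)) \<partial>lborel)"
    by (rule nn_integral_cmult) simp
  also have "(\<integral>\<^sup>+ x. ennreal (std_gaussian (B *v x - w)) \<partial>lborel) = ennreal (1 / \<bar>det B\<bar>)"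
  proof -
    have "ennreal \<bar>det B\<bar> * (\<integral>\<^sup>+ x. ennreal (std_gaussian (B *v x - w)) \<partial>lborel) = 1"
      using nn_integral_lborel_affine[OF B, of "\<lambda>y. ennreal (std_gaussian y)" w]
      by (simp add: nn_integral_std_gaussian)
    then have "ennreal (1 / \<bar>det B\<bar>) * (ennreal \<bar>det B\<bar> * (\<integral>\<^sup>+ x. ennreal (std_gaussian (B *v x - w)) \<partial>lborel)) = ennreal (1 / \<bar>det B\<bar>)"
      by simp
    moreover have "ennreal (1 / \<bar>det B\<bar>) * ennreal \<bar>det B\<bar> = 1"
      using \<open>det B \<noteq> 0\<close> by (simp add: ennreal_mult'[symmetric])
    ultimately show ?thesis by (simp add: mult.assoc[symmetric])
  qed
  also have "ennreal k * ennreal (1 / \<bar>det B\<bar>) =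
      ennreal (sqrt lam ^ CARD('n) / sqrt (det V) * exp ((matrix_norm (matrix_inv V) s)\<^sup>2 / 2))"
    using \<open>k > 0\<close>
    by (simp add: ennreal_mult'[symmetric] detV k_def matrix_norm_inv_factor[OF V] w_def)
  finally show ?thesis .
qed

text \<open>The total mass is the mixture integral for \<open>s = 0\<close> and \<open>V\<close>
  equal to \<open>lam\<close> times the identity, where the integrand is 1.\<close>

lemma prob_space_gaussian_prior:
  assumes "lam > 0"
  shows "prob_space (gaussian_prior lam :: (real^'n) measure)"
proof (rule prob_spaceI)
  let ?V = "lam *\<^sub>R mat 1 :: real^'n^'n"
  have V: "spd_factor ?V (sqrt lam *\<^sub>R mat 1)"
    by (rule spd_factor_scaled_identity[OF assms])
  have "det ?V = lam ^ CARD('n)"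
    by (subst det_diagonal) (auto simp: mat_def)
  moreover have "sqrt lam ^ CARD('n) > 0" using assms by simp
  ultimately have "(\<integral>\<^sup>+ x. 1 \<partial>(gaussian_prior lam :: (real^'n) measure)) = 1"
    using gaussian_mixture[OF V assms, of 0] assms
    by (simp add: matrix_norm_def scaled_identity_mult_vector power2_norm_eq_inner real_sqrt_power)
  then show "emeasure (gaussian_prior lam :: (real^'n) measure) (space (gaussian_prior lam)) = 1"
    by simp
qed

section \<open>Maximal inequality for mixtures\<close>

text \<open>A stopping argument: \<open>E n\<close> says that the level \<open>c\<close> has not
  been exceeded up to time \<open>n\<close>. The supermartingale property enters only in integrated
  form on these events, and each path that leaves them gives up a value of at least
  \<open>c\<close>.\<close>

lemma (in prob_space) ville_inequality:
  fixes N :: "nat \<Rightarrow> 'a \<Rightarrow> ennreal" and c :: ennreal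
  defines "E \<equiv> \<lambda>n. {\<omega> \<in> space M. \<forall>s\<le>n. N s \<omega> \<le> c}"
  assumes N [measurable]: "\<And>n. N n \<in> borel_measurable M"
    and N0: "(\<integral>\<^sup>+ \<omega>. N 0 \<omega> \<partial>M) \<le> 1"
    and step: "\<And>n. (\<integral>\<^sup>+ \<omega>. N (Suc n) \<omega> * indicator (E n) \<omega> \<partial>M) \<le> (\<integral>\<^sup>+ \<omega>. N n \<omega> * indicator (E n) \<omega> \<partial>M)"
  shows "c * emeasure M {\<omega> \<in> space M. \<exists>n. N n \<omega> > c} \<le> 1"
proof -
  have E [measurable]: "E n \<in> sets M" for n unfolding E_def by measurable
  \<comment> \<open>Markov's inequality on the part \<open>D - D'\<close> that is split off, with
    the integral over \<open>D'\<close> retained for the next round.\<close>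
  have split: "c * emeasure M (D - D') + (\<integral>\<^sup>+ \<omega>. f \<omega> * indicator D' \<omega> \<partial>M) \<le> (\<integral>\<^sup>+ \<omega>. f \<omega> * indicator D \<omega> \<partial>M)"
    if [measurable]: "D \<in> sets M" "D' \<in> sets M" "f \<in> borel_measurable M" and "D' \<subseteq> D"
      and f: "\<And>\<omega>. \<omega> \<in> D - D' \<Longrightarrow> c \<le> f \<omega>" for D D' and f :: "'a \<Rightarrow> ennreal"
  proof -
    have "c * emeasure M (D - D') + (\<integral>\<^sup>+ \<omega>. f \<omega> * indicator D' \<omega> \<partial>M)
      = (\<integral>\<^sup>+ \<omega>. c * indicator (D - D') \<omega> + f \<omega> * indicator D' \<omega> \<partial>M)"
      by (subst nn_integral_add) (auto simp: nn_integral_cmult_indicator)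
    also have "\<dots> \<le> (\<integral>\<^sup>+ \<omega>. f \<omega> * indicator D \<omega> \<partial>M)"
      using f \<open>D' \<subseteq> D\<close> by (intro nn_integral_mono) (auto split: split_indicator)
    finally show ?thesis .
  qed
  \<comment> \<open>The invariant: \<open>c\<close> times the probability of having crossed, plus
    the mass still running, never exceeds the initial mass.\<close>
  have main: "c * emeasure M (space M - E n) + (\<integral>\<^sup>+ \<omega>. N n \<omega> * indicator (E n) \<omega> \<partial>M) \<le> 1" for n
  proof (induction n)
    case 0
    have "c * emeasure M (space M - E 0) + (\<integral>\<^sup>+ \<omega>. N 0 \<omega> * indicator (E 0) \<omega> \<partial>M)
      \<le> (\<integral>\<^sup>+ \<omega>. N 0 \<omega> * indicator (space M) \<omega> \<partial>M)"
      by (rule split) (auto simp: E_def)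
    also have "\<dots> = (\<integral>\<^sup>+ \<omega>. N 0 \<omega> \<partial>M)" by (rule nn_integral_cong) auto
    finally show ?case using N0 by order
  next
    case (Suc n)
    have sub: "E (Suc n) \<subseteq> E n" by (auto simp: E_def)
    have new: "c \<le> N (Suc n) \<omega>" if "\<omega> \<in> E n - E (Suc n)" for \<omega>
      using that by (auto simp: E_def le_Suc_eq not_le)
    have "space M - E (Suc n) = (space M - E n) \<union> (E n - E (Suc n))"
      using sub sets.sets_into_space[OF E] by blast
    then have "emeasure M (space M - E (Suc n)) = emeasure M (space M - E n) + emeasure M (E n - E (Suc n))"
      by (simp only:) (rule plus_emeasure[symmetric], auto)
    then have "c * emeasure M (space M - E (Suc n)) + (\<integral>\<^sup>+ \<omega>. N (Suc n) \<omega> * indicator (E (Suc n)) \<omega> \<partial>M)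
      = c * emeasure M (space M - E n) +
        (c * emeasure M (E n - E (Suc n)) + (\<integral>\<^sup>+ \<omega>. N (Suc n) \<omega> * indicator (E (Suc n)) \<omega> \<partial>M))"
      by (simp add: distrib_left add.assoc)
    also have "\<dots> \<le> c * emeasure M (space M - E n) + (\<integral>\<^sup>+ \<omega>. N (Suc n) \<omega> * indicator (E n) \<omega> \<partial>M)"
      by (intro add_left_mono split) (use sub new in auto)
    also have "\<dots> \<le> c * emeasure M (space M - E n) + (\<integral>\<^sup>+ \<omega>. N n \<omega> * indicator (E n) \<omega> \<partial>M)"
      by (intro add_left_mono step)
    finally show ?case using Suc.IH by order
  qed
  have "{\<omega> \<in> space M. \<exists>n. N n \<omega> > c} = (\<Union>n. space M - E n)"
    unfolding E_def not_le[symmetric] by blast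
  also have "emeasure M \<dots> = (SUP n. emeasure M (space M - E n))"
    by (rule SUP_emeasure_incseq[symmetric]) (auto simp: incseq_def E_def)
  also have "c * \<dots> = (SUP n. c * emeasure M (space M - E n))"
    by (rule SUP_mult_left_ennreal)
  also have "\<dots> \<le> 1"
  proof (rule SUP_least)
    fix n show "c * emeasure M (space M - E n) \<le> 1"
      using main[of n] by (meson add_increasing2 dual_order.trans le_iff_add)
  qed
  finally show ?thesis .
qed

text \<open>The exponential factor has conditional mean at most 1. The sub-Gaussian bound holds
  almost everywhere for each fixed parameter, whereas \<open>u (A \<omega>)\<close> is random;
  splitting by the finitely many values of \<open>A\<close> makes the parameter constant on each
  piece.\<close>

lemma subgaussian_exp_le:
  fixes u :: "'a::finite \<Rightarrow> real" and M :: "'w measure"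
  assumes M: "prob_space M" and F: "subalgebra M F" and sub: "cond_centered_subgaussian M F R \<eta>" and "R > 0"
    and g [measurable]: "g \<in> borel_measurable F" and A [measurable]: "A \<in> measurable F (count_space UNIV)"
  shows "(\<integral>\<^sup>+ \<omega>. g \<omega> * ennreal (exp (u (A \<omega>) * \<eta> \<omega> / R - (u (A \<omega>))\<^sup>2 / 2)) \<partial>M) \<le> (\<integral>\<^sup>+ \<omega>. g \<omega> \<partial>M)"
proof -
  interpret prob_space M by fact
  interpret finite_measure_subalgebra M F by unfold_locales fact
  have gM [measurable]: "g \<in> borel_measurable M" and AM [measurable]: "A \<in> measurable M (count_space UNIV)"
    by (rule measurable_from_subalg[OF F g], rule measurable_from_subalg[OF F A])
  have \<eta> [measurable]: "\<eta> \<in> borel_measurable M"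
    using sub by (auto simp: cond_centered_subgaussian_def)
  define I where "I a \<omega> = g \<omega> * indicator (A -` {a}) \<omega>" for a \<omega>
  have IF [measurable]: "I a \<in> borel_measurable F" for a
  proof -
    have "(\<lambda>\<omega>. g \<omega> * indicator {a} (A \<omega>)) \<in> borel_measurable F" by measurable
    then show ?thesis by (simp add: I_def[abs_def] indicator_def)
  qed
  have IM [measurable]: "I a \<in> borel_measurable M" for a by (rule measurable_from_subalg[OF F IF])
  have sum_I: "(\<Sum>a\<in>UNIV. I a \<omega> * h a) = g \<omega> * h (A \<omega>)" for \<omega> and h :: "'a \<Rightarrow> ennreal"
  proof -
    have "(\<Sum>a\<in>UNIV. I a \<omega> * h a) = (\<Sum>a\<in>UNIV. if a = A \<omega> then g \<omega> * h a else 0)"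
      by (rule sum.cong) (auto simp: I_def)
    then show ?thesis by simp
  qed
  have one: "(\<integral>\<^sup>+ \<omega>. I a \<omega> * ennreal (exp (u a * \<eta> \<omega> / R - (u a)\<^sup>2 / 2)) \<partial>M) \<le> (\<integral>\<^sup>+ \<omega>. I a \<omega> * 1 \<partial>M)" for a
  proof -
    let ?k = "ennreal (exp (- (u a)\<^sup>2 / 2))" and ?e = "\<lambda>\<omega>. ennreal (exp (u a / R * \<eta> \<omega>))"
    have "I a \<omega> * ennreal (exp (u a * \<eta> \<omega> / R - (u a)\<^sup>2 / 2)) = ?k * (I a \<omega> * ?e \<omega>)" for \<omega>
    proof -
      have "exp (u a * \<eta> \<omega> / R - (u a)\<^sup>2 / 2) = exp (- (u a)\<^sup>2 / 2) * exp (u a / R * \<eta> \<omega>)"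
        by (simp add: exp_add[symmetric])
      then show ?thesis by (simp add: ennreal_mult' mult_ac)
    qed
    then have "(\<integral>\<^sup>+ \<omega>. I a \<omega> * ennreal (exp (u a * \<eta> \<omega> / R - (u a)\<^sup>2 / 2)) \<partial>M) = ?k * (\<integral>\<^sup>+ \<omega>. I a \<omega> * ?e \<omega> \<partial>M)"
      by (simp add: nn_integral_cmult)
    also have "(\<integral>\<^sup>+ \<omega>. I a \<omega> * ?e \<omega> \<partial>M) = (\<integral>\<^sup>+ \<omega>. I a \<omega> * nn_cond_exp M F ?e \<omega> \<partial>M)"
      by (rule nn_cond_exp_intg[symmetric]) measurable
    also have "?k * \<dots> \<le> ?k * (\<integral>\<^sup>+ \<omega>. I a \<omega> * ennreal (exp ((u a)\<^sup>2 / 2)) \<partial>M)"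
    proof (intro mult_left_mono nn_integral_mono_AE)
      \<comment> \<open>The sub-Gaussian bound is taken at the parameter \<open>u a / R\<close>, so
        that \<open>R\<close> cancels against the normalisation of the noise.\<close>
      have "(u a / R)\<^sup>2 * R\<^sup>2 = (u a)\<^sup>2" using \<open>R > 0\<close> by (simp add: power_divide)
      then have "AE \<omega> in M. nn_cond_exp M F ?e \<omega> \<le> ennreal (exp ((u a)\<^sup>2 / 2))"
        using sub unfolding cond_centered_subgaussian_def by metis
      then show "AE \<omega> in M. I a \<omega> * nn_cond_exp M F ?e \<omega> \<le> I a \<omega> * ennreal (exp ((u a)\<^sup>2 / 2))"
        by eventually_elim (rule mult_left_mono, auto)
    qed simp
    also have "\<dots> = ?k * ennreal (exp ((u a)\<^sup>2 / 2)) * (\<integral>\<^sup>+ \<omega>. I a \<omega> \<partial>M)"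
      by (simp add: nn_integral_multc mult_ac)
    also have "?k * ennreal (exp ((u a)\<^sup>2 / 2)) = 1"
      by (simp add: ennreal_mult'[symmetric] exp_add[symmetric])
    finally show ?thesis by simp
  qed
  have "(\<integral>\<^sup>+ \<omega>. g \<omega> * ennreal (exp (u (A \<omega>) * \<eta> \<omega> / R - (u (A \<omega>))\<^sup>2 / 2)) \<partial>M)
     = (\<integral>\<^sup>+ \<omega>. (\<Sum>a\<in>UNIV. I a \<omega> * ennreal (exp (u a * \<eta> \<omega> / R - (u a)\<^sup>2 / 2))) \<partial>M)"
    by (simp add: sum_I)
  also have "\<dots> = (\<Sum>a\<in>UNIV. \<integral>\<^sup>+ \<omega>. I a \<omega> * ennreal (exp (u a * \<eta> \<omega> / R - (u a)\<^sup>2 / 2)) \<partial>M)"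
    by (rule nn_integral_sum) measurable
  also have "\<dots> \<le> (\<Sum>a\<in>UNIV. \<integral>\<^sup>+ \<omega>. I a \<omega> * 1 \<partial>M)" by (rule sum_mono) (rule one)
  also have "\<dots> = (\<integral>\<^sup>+ \<omega>. (\<Sum>a\<in>UNIV. I a \<omega> * 1) \<partial>M)"
    by (rule nn_integral_sum[symmetric]) measurable
  also have "\<dots> = (\<integral>\<^sup>+ \<omega>. g \<omega> \<partial>M)" using sum_I[of _ "\<lambda>_. 1"] by simp
  finally show ?thesis .
qed

section \<open>The history of the bandit and the mixture of exponential supermartingales\<close>

lemma space_past_and_action [simp]: "space (past_and_action M Act Y t) = space M"
  by (simp add: past_and_action_def)

lemma
  assumes "t \<ge> 1"
  shows past_and_action_measurable_action: "s \<in> {1..t} \<Longrightarrow> Act s \<in> measurable (past_and_action M Act Y t) (count_space UNIV)"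
    and past_and_action_measurable_reward: "s \<in> {1..<t} \<Longrightarrow> Y s \<in> borel_measurable (past_and_action M Act Y t)"
proof -
  let ?F = "past_and_action M Act Y t"
  let ?f = "\<lambda>\<omega>. (\<lambda>s\<in>{1..<t}. (Act s \<omega>, Y s \<omega>), Act t \<omega>)"
  have f: "?f \<in> measurable ?F (PiM {1..<t} (\<lambda>_. count_space UNIV \<Otimes>\<^sub>M borel) \<Otimes>\<^sub>M count_space UNIV)"
    unfolding past_and_action_def
    by (rule measurable_vimage_algebra1) (auto simp: space_PiM space_pair_measure)
  have last: "Act t \<in> measurable ?F (count_space UNIV)"
    using measurable_compose[OF f measurable_snd] by simp
  have pair: "(\<lambda>\<omega>. (Act s \<omega>, Y s \<omega>)) \<in> measurable ?F (count_space UNIV \<Otimes>\<^sub>M borel)" if "s \<in> {1..<t}" for s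
    using measurable_compose[OF measurable_compose[OF f measurable_fst]
        measurable_component_singleton[OF that]] that by simp
  show "Act s \<in> measurable ?F (count_space UNIV)" if "s \<in> {1..t}"
    using measurable_compose[OF pair measurable_fst, of s] last that by (cases "s = t") auto
  show "Y s \<in> borel_measurable ?F" if "s \<in> {1..<t}"
    using measurable_compose[OF pair measurable_snd, of s] that by simp
qed

lemma subalgebra_past_and_action:
  assumes "t \<ge> 1"
    and Act: "\<And>t. t \<ge> 1 \<Longrightarrow> Act t \<in> measurable M (count_space UNIV)"
    and Y: "\<And>t. t \<ge> 1 \<Longrightarrow> Y t \<in> borel_measurable M"
  shows "subalgebra M (past_and_action M Act Y t)"
  unfolding subalgebra_def
proof
  show "sets (past_and_action M Act Y t) \<subseteq> sets M"
    unfolding past_and_action_def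
  proof (rule sets_image_in_sets)
    show "(\<lambda>\<omega>. (\<lambda>s\<in>{1..<t}. (Act s \<omega>, Y s \<omega>), Act t \<omega>))
      \<in> M \<rightarrow>\<^sub>M Pi\<^sub>M {1..<t} (\<lambda>_. count_space UNIV \<Otimes>\<^sub>M borel) \<Otimes>\<^sub>M count_space UNIV"
      by (intro measurable_Pair measurable_restrict Act Y) (use \<open>t \<ge> 1\<close> in auto)
  qed simp
qed simp

text \<open>The exponential supermartingale of the normalised noise in the direction \<open>x\<close>. The noise is
  read off the trajectory as \<open>y s - m $ act s\<close>, which makes it adapted to the past.\<close>

definition exp_process :: "real^'c^'a \<Rightarrow> real^'a \<Rightarrow> real \<Rightarrow> (nat \<Rightarrow> 'a) \<Rightarrow> (nat \<Rightarrow> real) \<Rightarrow> real^'c \<Rightarrow> nat \<Rightarrow> real" where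
  "exp_process U m R act y x n =
     exp (\<Sum>s=1..n. (x \<bullet> U $ act s) * (y s - m $ act s) / R - (x \<bullet> U $ act s)\<^sup>2 / 2)"

lemma exp_process_nonneg: "0 \<le> exp_process U m R act y x n"
  by (simp add: exp_process_def)

lemma exp_process_Suc: "exp_process U m R act y x (Suc n) = exp_process U m R act y x n *
   exp ((x \<bullet> U $ act (Suc n)) * (y (Suc n) - m $ act (Suc n)) / R - (x \<bullet> U $ act (Suc n))\<^sup>2 / 2)"
  by (simp add: exp_process_def exp_add)

text \<open>Joint measurability in outcome and direction, as Fubini demands. \<open>G\<close> is
  kept general to serve both for the whole space and for the sigma-algebra of the past.\<close>

lemma exp_process_measurable:
  fixes U :: "real^'c^'a"
  assumes Act: "\<And>s. s \<in> {1..n} \<Longrightarrow> Act s \<in> measurable G (count_space UNIV)"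
    and Y: "\<And>s. s \<in> {1..n} \<Longrightarrow> Y s \<in> borel_measurable G"
  shows "(\<lambda>(\<omega>, x). exp_process U m R (\<lambda>s. Act s \<omega>) (\<lambda>s. Y s \<omega>) x n) \<in> borel_measurable (G \<Otimes>\<^sub>M borel)"
proof -
  have "(\<lambda>z. (snd z \<bullet> U $ Act s (fst z)) * (Y s (fst z) - m $ Act s (fst z)) / R
      - (snd z \<bullet> U $ Act s (fst z))\<^sup>2 / 2) \<in> borel_measurable (G \<Otimes>\<^sub>M borel)" if "s \<in> {1..n}" for s
  proof -
    have [measurable]: "(\<lambda>\<omega>. U $ Act s \<omega>) \<in> borel_measurable G" "(\<lambda>\<omega>. m $ Act s \<omega>) \<in> borel_measurable G"
      by (rule measurable_compose[OF Act[OF that]], simp)+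
    note [measurable] = Y[OF that]
    show ?thesis by measurable
  qed
  then show ?thesis
    unfolding exp_process_def case_prod_beta
    by (intro measurable_compose[OF _ borel_measurable_exp] borel_measurable_sum)
qed

text \<open>The method of mixtures: the one-step inequality holds for each fixed direction
  \<open>x\<close>, Fubini carries it over to the average \<open>N\<close> over \<open>P\<close>,
  and Ville's inequality controls all times at once.\<close>

lemma mixture_maximal_inequality:
  fixes U :: "real^'c^'a" and P :: "(real^'c) measure" and M :: "'w measure"
  assumes M: "prob_space M" and P: "prob_space P" and sP [measurable_cong]: "sets P = sets borel" and "R > 0" and "0 < \<delta>"
    and Act: "\<And>t. t \<ge> 1 \<Longrightarrow> Act t \<in> measurable M (count_space UNIV)"
    and Y: "\<And>t. t \<ge> 1 \<Longrightarrow> Y t \<in> borel_measurable M"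
    and eq: "\<And>t \<omega>. t \<ge> 1 \<Longrightarrow> \<omega> \<in> space M \<Longrightarrow> Y t \<omega> = m $ Act t \<omega> + \<eta> t \<omega>"
    and sub: "\<And>t. t \<ge> 1 \<Longrightarrow> cond_centered_subgaussian M (past_and_action M Act Y t) R (\<eta> t)"
  defines "N \<equiv> \<lambda>n \<omega>. \<integral>\<^sup>+ x. ennreal (exp_process U m R (\<lambda>s. Act s \<omega>) (\<lambda>s. Y s \<omega>) x n) \<partial>P"
  defines "G \<equiv> {\<omega> \<in> space M. \<forall>n. N n \<omega> \<le> ennreal (1 / \<delta>)}"
  shows "G \<in> sets M" and "1 - \<delta> \<le> measure M G"
proof -
  interpret prob_space M by fact
  interpret prior: prob_space P by fact
  interpret pair_sigma_finite M P ..
  \<comment> \<open>The index \<open>Suc n\<close> gives the rewards of rounds up to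
    \<open>n\<close> together with the action of round \<open>Suc n\<close>: the process at time
    \<open>n\<close> and the next feature vector are known, the next noise is not.\<close>
  let ?F = "\<lambda>n. past_and_action M Act Y (Suc n)"
  let ?L = "\<lambda>n \<omega> x. ennreal (exp_process U m R (\<lambda>s. Act s \<omega>) (\<lambda>s. Y s \<omega>) x n)"
  define E where "E n = {\<omega> \<in> space M. \<forall>s\<le>n. N s \<omega> \<le> ennreal (1 / \<delta>)}" for n
  have LM [measurable]: "case_prod (?L n) \<in> borel_measurable (M \<Otimes>\<^sub>M borel)" for n
    using exp_process_measurable[of n Act M Y U m R] Act Y by (simp add: case_prod_beta)
  have LF: "case_prod (?L k) \<in> borel_measurable (?F n \<Otimes>\<^sub>M borel)" if "k \<le> n" for k n
    using exp_process_measurable[of k Act "?F n" Y U m R] that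
    by (simp add: case_prod_beta past_and_action_measurable_action past_and_action_measurable_reward)
  have NM [measurable]: "N n \<in> borel_measurable M" for n
    using prior.borel_measurable_nn_integral[of "?L n" M] LM by (simp add: N_def cong: measurable_cong_sets)
  have NF: "N k \<in> borel_measurable (?F n)" if "k \<le> n" for k n
    using prior.borel_measurable_nn_integral[of "?L k" "?F n"] LF[OF that]
    by (simp add: N_def cong: measurable_cong_sets)
  have EF: "E n \<in> sets (?F n)" for n
  proof -
    have "{\<omega> \<in> space (?F n). \<forall>s\<in>{..n}. N s \<omega> \<le> ennreal (1 / \<delta>)} \<in> sets (?F n)"
    proof (intro sets.sets_Collect_finite_All)
      fix s assume "s \<in> {..n}"
      then have [measurable]: "N s \<in> borel_measurable (?F n)" by (intro NF) simp
      show "{\<omega> \<in> space (?F n). N s \<omega> \<le> ennreal (1 / \<delta>)} \<in> sets (?F n)" by measurable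
    qed simp
    also have "{\<omega> \<in> space (?F n). \<forall>s\<in>{..n}. N s \<omega> \<le> ennreal (1 / \<delta>)} = E n"
      unfolding E_def by auto
    finally show ?thesis .
  qed
  have F: "subalgebra M (?F n)" for n
    by (rule subalgebra_past_and_action[OF _ Act Y]) simp_all
  have EM [measurable]: "E n \<in> sets M" for n using EF[of n] F[of n] unfolding subalgebra_def by blast
  have step_x: "(\<integral>\<^sup>+ \<omega>. ?L (Suc n) \<omega> x * indicator (E n) \<omega> \<partial>M) \<le> (\<integral>\<^sup>+ \<omega>. ?L n \<omega> x * indicator (E n) \<omega> \<partial>M)" for n x
  proof -
    have "(\<lambda>\<omega>. ?L n \<omega> x) \<in> borel_measurable (?F n)"
      using measurable_compose[OF measurable_Pair2'[of x borel "?F n"] LF[OF order_refl]] by simp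
    then have g: "(\<lambda>\<omega>. ?L n \<omega> x * indicator (E n) \<omega>) \<in> borel_measurable (?F n)"
      using EF by simp
    have A: "Act (Suc n) \<in> measurable (?F n) (count_space UNIV)"
      by (rule past_and_action_measurable_action) auto
    have "(\<integral>\<^sup>+ \<omega>. ?L (Suc n) \<omega> x * indicator (E n) \<omega> \<partial>M) =
      (\<integral>\<^sup>+ \<omega>. (?L n \<omega> x * indicator (E n) \<omega>) *
        ennreal (exp ((x \<bullet> U $ Act (Suc n) \<omega>) * \<eta> (Suc n) \<omega> / R - (x \<bullet> U $ Act (Suc n) \<omega>)\<^sup>2 / 2)) \<partial>M)"
      by (rule nn_integral_cong) (simp add: exp_process_Suc eq ennreal_mult'[OF exp_process_nonneg] mult_ac)
    also have "\<dots> \<le> (\<integral>\<^sup>+ \<omega>. ?L n \<omega> x * indicator (E n) \<omega> \<partial>M)"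
      by (rule subgaussian_exp_le[OF M F sub \<open>R > 0\<close> g A, where u = "\<lambda>a. x \<bullet> U $ a"]) simp
    finally show ?thesis .
  qed
  have Fubini: "(\<integral>\<^sup>+ \<omega>. N k \<omega> * indicator (E n) \<omega> \<partial>M) = (\<integral>\<^sup>+ x. (\<integral>\<^sup>+ \<omega>. ?L k \<omega> x * indicator (E n) \<omega> \<partial>M) \<partial>P)" for k n
  proof -
    have "(\<integral>\<^sup>+ \<omega>. N k \<omega> * indicator (E n) \<omega> \<partial>M) = (\<integral>\<^sup>+ \<omega>. (\<integral>\<^sup>+ x. ?L k \<omega> x * indicator (E n) \<omega> \<partial>P) \<partial>M)"
    proof (rule nn_integral_cong)
      fix \<omega> assume "\<omega> \<in> space M"
      then have "(\<lambda>x. ?L k \<omega> x) \<in> borel_measurable borel"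
        using measurable_compose[OF measurable_Pair1'[of \<omega> M borel] LM[of k]] by simp
      then have "?L k \<omega> \<in> borel_measurable P" by (simp cong: measurable_cong_sets)
      then show "N k \<omega> * indicator (E n) \<omega> = (\<integral>\<^sup>+ x. ?L k \<omega> x * indicator (E n) \<omega> \<partial>P)"
        unfolding N_def by (rule nn_integral_multc[symmetric])
    qed
    also have "\<dots> = (\<integral>\<^sup>+ x. (\<integral>\<^sup>+ \<omega>. ?L k \<omega> x * indicator (E n) \<omega> \<partial>M) \<partial>P)"
    proof (rule Fubini'[symmetric])
      have "(\<lambda>z. case_prod (?L k) z * indicator (E n) (fst z)) \<in> borel_measurable (M \<Otimes>\<^sub>M borel)"
        by (intro borel_measurable_times_ennreal LM measurable_compose[OF measurable_fst]) simp
      then show "case_prod (\<lambda>\<omega> x. ?L k \<omega> x * indicator (E n) \<omega>) \<in> borel_measurable (M \<Otimes>\<^sub>M P)"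
        by (simp add: case_prod_beta' cong: measurable_cong_sets)
    qed
    finally show ?thesis .
  qed
  have "ennreal (1 / \<delta>) * emeasure M {\<omega> \<in> space M. \<exists>n. N n \<omega> > ennreal (1 / \<delta>)} \<le> 1"
  proof (rule ville_inequality[OF NM])
    show "(\<integral>\<^sup>+ \<omega>. N 0 \<omega> \<partial>M) \<le> 1"
      by (simp add: N_def exp_process_def prior.emeasure_space_1 emeasure_space_1)
    show "(\<integral>\<^sup>+ \<omega>. N (Suc n) \<omega> * indicator {\<omega> \<in> space M. \<forall>s\<le>n. N s \<omega> \<le> ennreal (1 / \<delta>)} \<omega> \<partial>M)
      \<le> (\<integral>\<^sup>+ \<omega>. N n \<omega> * indicator {\<omega> \<in> space M. \<forall>s\<le>n. N s \<omega> \<le> ennreal (1 / \<delta>)} \<omega> \<partial>M)" for n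
      unfolding E_def[symmetric] Fubini by (intro nn_integral_mono step_x)
  qed
  also have "{\<omega> \<in> space M. \<exists>n. N n \<omega> > ennreal (1 / \<delta>)} = space M - G"
    unfolding G_def not_le[symmetric] by blast
  finally have "ennreal (1 / \<delta>) * emeasure M (space M - G) \<le> 1" .
  then have "ennreal (1 / \<delta> * prob (space M - G)) \<le> 1"
    unfolding emeasure_eq_measure using \<open>0 < \<delta>\<close> by (subst ennreal_mult') auto
  then have le: "prob (space M - G) \<le> \<delta>"
    using \<open>0 < \<delta>\<close> unfolding ennreal_le_1 by (simp add: pos_divide_le_eq)
  show good: "G \<in> sets M"
    unfolding G_def
  proof (intro sets.sets_Collect_countable_All)
    show "{\<omega> \<in> space M. N n \<omega> \<le> ennreal (1 / \<delta>)} \<in> sets M" for n by measurable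
  qed
  show "1 - \<delta> \<le> prob G"
    using le prob_compl[OF good] by simp
qed

section \<open>Regret of OFUL\<close>

lemma oful_V_0: "oful_V U lam act 0 = lam *\<^sub>R mat 1"
  by (simp add: oful_V_def)

lemma oful_V_Suc: "oful_V U lam act (Suc n) = oful_V U lam act n + outer (U $ act (Suc n))"
  by (simp add: oful_V_def outer_def add.assoc)

lemma oful_V_mult_vector:
  "oful_V U lam act n *v x = lam *\<^sub>R x + (\<Sum>s=1..n. (U $ act s \<bullet> x) *\<^sub>R U $ act s)"
  by (induction n)
    (simp_all add: oful_V_0 oful_V_Suc scaled_identity_mult_vector matrix_vector_mult_add_rdistrib
      outer_mult_vector)

lemma oful_V_quadratic:
  "x \<bullet> (oful_V U lam act n *v x) = lam * (norm x)\<^sup>2 + (\<Sum>s=1..n. (x \<bullet> U $ act s)\<^sup>2)"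
  unfolding oful_V_mult_vector power2_norm_eq_inner
  by (simp add: inner_add_right inner_sum_right power2_eq_square inner_commute)

lemma oful_V_spd:
  assumes "lam > 0"
  shows "\<exists>B. spd_factor (oful_V U lam act n) B"
proof (induction n)
  case 0
  show ?case using spd_factor_scaled_identity[OF assms] by (auto simp: oful_V_0)
next
  case (Suc n)
  then show ?case by (auto simp: oful_V_Suc dest: spd_factor_add_outer)
qed

lemma matrix_norm_inv_oful_le:
  assumes "lam > 0"
  shows "matrix_norm (matrix_inv (oful_V U lam act n)) u \<le> norm u / sqrt lam"
proof -
  obtain B where B: "spd_factor (oful_V U lam act n) B" using oful_V_spd[OF assms] by blast
  show ?thesis
    by (rule matrix_norm_inv_le[OF B assms]) (simp add: oful_V_quadratic sum_nonneg)
qed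

lemma det_scaled_identity: "det (lam *\<^sub>R mat 1 :: real^'n^'n) = lam ^ CARD('n)"
  by (subst det_diagonal) (auto simp: mat_def)

lemma trace_oful_V_le:
  fixes U :: "real^'c^'a"
  assumes "\<And>a. norm (U $ a) \<le> R_X"
  shows "trace (oful_V U lam act n) \<le> real CARD('c) * lam + real n * R_X\<^sup>2"
proof -
  have outer: "trace (outer u) = (norm u)\<^sup>2" for u :: "real^'c"
    by (simp add: trace_def outer_def power2_norm_eq_inner inner_vec_def)
  have "trace (oful_V U lam act n) = real CARD('c) * lam + (\<Sum>s=1..n. (norm (U $ act s))\<^sup>2)"
  proof (induction n)
    case 0
    show ?case by (simp add: oful_V_0 trace_def mat_def)
  next
    case (Suc n)
    then show ?case by (simp add: oful_V_Suc trace_add outer)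
  qed
  also have "(\<Sum>s=1..n. (norm (U $ act s))\<^sup>2) \<le> (\<Sum>s=1..n. R_X\<^sup>2)"
    by (intro sum_mono power_mono assms) simp
  finally show ?thesis by simp
qed

text \<open>The determinant-trace inequality; subtracting \<open>ln lam\<close> in each dimension
  normalises the bound to 0 for \<open>n = 0\<close>.\<close>

lemma ln_det_oful_V_le:
  fixes U :: "real^'c^'a"
  assumes "lam > 0" and "\<And>a. norm (U $ a) \<le> R_X"
  shows "ln (det (oful_V U lam act n)) - real CARD('c) * ln lam
    \<le> real CARD('c) * ln (1 + real n * R_X\<^sup>2 / (lam * real CARD('c)))"
proof -
  let ?C = "real CARD('c)" and ?V = "oful_V U lam act n"
  obtain B where B: "spd_factor ?V B" using oful_V_spd[OF assms(1)] by blast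
  have "trace ?V > 0"
  proof -
    have "axis i 1 \<bullet> (?V *v axis i 1) > 0" for i
      unfolding oful_V_quadratic using \<open>lam > 0\<close> by (simp add: add_pos_nonneg sum_nonneg)
    then have "?V $ i $ i > 0" for i
      by (simp add: inner_axis' matrix_vector_mul_component inner_axis)
    then show ?thesis unfolding trace_def by (intro sum_pos) auto
  qed
  have C: "?C > 0" by simp
  have "trace ?V / ?C \<le> (?C * lam + real n * R_X\<^sup>2) / ?C"
    by (intro divide_right_mono trace_oful_V_le assms) simp
  also have "\<dots> = lam * (1 + real n * R_X\<^sup>2 / (lam * ?C))"
    using \<open>lam > 0\<close> C by (simp add: field_simps)
  finally have "trace ?V / ?C \<le> lam * (1 + real n * R_X\<^sup>2 / (lam * ?C))" .
  then have "ln (trace ?V / ?C) \<le> ln (lam * (1 + real n * R_X\<^sup>2 / (lam * ?C)))"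
    using \<open>trace ?V > 0\<close> C by (intro ln_mono) auto
  also have "\<dots> = ln lam + ln (1 + real n * R_X\<^sup>2 / (lam * ?C))"
    using \<open>lam > 0\<close> by (intro ln_mult_pos) (auto intro!: add_pos_nonneg)
  finally have "?C * ln (trace ?V / ?C) \<le> ?C * (ln lam + ln (1 + real n * R_X\<^sup>2 / (lam * ?C)))"
    by (intro mult_left_mono) auto
  then show ?thesis using ln_det_le_ln_trace[OF B] by (simp add: distrib_left)
qed

lemma le_two_ln_one_plus:
  fixes x :: real
  assumes "0 \<le> x" "x \<le> 1"
  shows "x \<le> 2 * ln (1 + x)"
proof -
  have "exp (x / 2) \<le> 1 + x / 2 + (x / 2)\<^sup>2" using assms by (intro exp_bound) auto
  also have "\<dots> \<le> 1 + x" using assms mult_left_mono[of x 1 x] by (simp add: power2_eq_square)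
  finally have "x / 2 \<le> ln (1 + x)" using assms by (subst ln_ge_iff) simp_all
  then show ?thesis by simp
qed

text \<open>By the matrix determinant lemma the terms \<open>ln (1 + (w t)\<^sup>2)\<close>
  telescope to the growth of the log-determinant. The assumption
  \<open>R_X\<^sup>2 \<le> lam\<close> gives \<open>(w t)\<^sup>2 \<le> 1\<close>, where
  \<open>x \<le> 2 * ln (1 + x)\<close> applies.\<close>

lemma elliptical_potential:
  fixes U :: "real^'c^'a"
  assumes "lam > 0" "R_X\<^sup>2 \<le> lam" and U: "\<And>a. norm (U $ a) \<le> R_X"
  shows "(\<Sum>t=1..T. (matrix_norm (matrix_inv (oful_V U lam act (t - 1))) (U $ act t))\<^sup>2)
    \<le> 2 * (real CARD('c) * ln (1 + real T * R_X\<^sup>2 / (lam * real CARD('c))))"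
proof -
  define w where "w t = matrix_norm (matrix_inv (oful_V U lam act (t - 1))) (U $ act t)" for t
  have le1: "(w t)\<^sup>2 \<le> 1" for t
  proof -
    obtain B where B: "spd_factor (oful_V U lam act (t - 1)) B" using oful_V_spd[OF assms(1)] by blast
    have "w t \<le> norm (U $ act t) / sqrt lam" unfolding w_def by (rule matrix_norm_inv_oful_le[OF assms(1)])
    then have "(w t)\<^sup>2 \<le> (norm (U $ act t) / sqrt lam)\<^sup>2"
      by (rule power_mono) (unfold w_def, rule matrix_norm_inv_nonneg[OF B])
    also have "\<dots> = (norm (U $ act t))\<^sup>2 / lam" using assms(1) by (simp add: power_divide)
    also have "\<dots> \<le> R_X\<^sup>2 / lam" using assms(1) U by (intro divide_right_mono power_mono) auto
    also have "\<dots> \<le> 1" using assms by simp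
    finally show ?thesis .
  qed
  have "(\<Sum>t=1..T. ln (1 + (w t)\<^sup>2)) = ln (det (oful_V U lam act T)) - real CARD('c) * ln lam"
  proof (induction T)
    case 0
    show ?case using assms(1) by (simp add: oful_V_0 det_scaled_identity ln_realpow)
  next
    case (Suc T)
    obtain B where B: "spd_factor (oful_V U lam act T) B" using oful_V_spd[OF assms(1)] by blast
    have "ln (det (oful_V U lam act (Suc T))) = ln (det (oful_V U lam act T)) + ln (1 + (w (Suc T))\<^sup>2)"
      unfolding oful_V_Suc det_add_outer[OF B]
      using spd_factor_det_pos[OF B] by (simp add: w_def ln_mult_pos add_pos_nonneg)
    then show ?case using Suc by simp
  qed
  also have "\<dots> \<le> real CARD('c) * ln (1 + real T * R_X\<^sup>2 / (lam * real CARD('c)))"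
    by (rule ln_det_oful_V_le[OF assms(1) U])
  finally have "2 * (\<Sum>t=1..T. ln (1 + (w t)\<^sup>2)) \<le> 2 * (real CARD('c) * ln (1 + real T * R_X\<^sup>2 / (lam * real CARD('c))))"
    by simp
  moreover have "(\<Sum>t=1..T. (w t)\<^sup>2) \<le> (\<Sum>t=1..T. 2 * ln (1 + (w t)\<^sup>2))"
    by (intro sum_mono le_two_ln_one_plus le1) simp
  ultimately show ?thesis by (simp add: w_def sum_distrib_left)
qed

section \<open>Confidence radius and concentration of the estimate\<close>

lemma two_ln_radius_argument:
  fixes U :: "real^'c^'a"
  assumes "lam > 0" "\<delta> > 0"
  shows "2 * ln (sqrt (det (oful_V U lam act n)) * lam powr (- (real CARD('c) / 2)) / \<delta>)
    = ln (det (oful_V U lam act n)) - real CARD('c) * ln lam + 2 * ln (1 / \<delta>)"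
proof -
  obtain B where B: "spd_factor (oful_V U lam act n) B" using oful_V_spd[OF assms(1)] by blast
  have "det (oful_V U lam act n) > 0" by (rule spd_factor_det_pos[OF B])
  then show ?thesis using assms by (simp add: ln_div ln_mult_pos ln_sqrt ln_powr)
qed

text \<open>A bound by the horizon \<open>T\<close> that is uniform in the rounds before it, so that
  the radius can be taken out of the regret sum.\<close>

lemma oful_radius_le:
  fixes U :: "real^'c^'a"
  assumes "lam > 0" "\<delta> > 0" "R > 0" and U: "\<And>a. norm (U $ a) \<le> R_X" and "n \<le> T"
  shows "oful_radius U lam R_Theta R \<delta> act n \<le> sqrt lam * R_Theta
    + R * sqrt (2 * ln (1 / \<delta>) + real CARD('c) * ln (1 + real T * R_X\<^sup>2 / (lam * real CARD('c))))"
proof -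
  let ?k = "\<lambda>n. real CARD('c) * ln (1 + real n * R_X\<^sup>2 / (lam * real CARD('c)))"
  have "?k n \<le> ?k T"
    using assms by (intro mult_left_mono ln_mono add_left_mono divide_right_mono mult_right_mono) (auto intro: add_pos_nonneg)
  then have "ln (det (oful_V U lam act n)) - real CARD('c) * ln lam + 2 * ln (1 / \<delta>) \<le> 2 * ln (1 / \<delta>) + ?k T"
    using ln_det_oful_V_le[OF assms(1) U, where n=n and act=act] by linarith
  then show ?thesis
    unfolding oful_radius_def two_ln_radius_argument[OF assms(1,2)]
    using \<open>R > 0\<close> by simp
qed

text \<open>The self-normalised bound: the Gaussian average of the exponential process is known in
  closed form, and the inequality against \<open>1 / \<delta>\<close> is solved for the weighted
  norm of the noise by taking logarithms.\<close>

lemma matrix_norm_inv_noise_le: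
  fixes U :: "real^'c^'a" and m :: "real^'a" and act :: "nat \<Rightarrow> 'a" and y :: "nat \<Rightarrow> real"
  defines "S \<equiv> \<lambda>n. \<Sum>s=1..n. (y s - m $ act s) *\<^sub>R U $ act s"
  assumes "lam > 0" "\<delta> > 0" "R > 0"
    and good: "(\<integral>\<^sup>+ x. ennreal (exp_process U m R act y x n) \<partial>gaussian_prior lam) \<le> ennreal (1 / \<delta>)"
  shows "matrix_norm (matrix_inv (oful_V U lam act n)) (S n)
    \<le> R * sqrt (2 * ln (sqrt (det (oful_V U lam act n)) * lam powr (- (real CARD('c) / 2)) / \<delta>))"
proof -
  let ?V = "oful_V U lam act n"
  obtain B where B: "spd_factor ?V B" using oful_V_spd[OF assms(2)] by blast
  have det: "det ?V > 0" by (rule spd_factor_det_pos[OF B])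
  define q where "q = matrix_norm (matrix_inv ?V) (S n)"
  have "q \<ge> 0" unfolding q_def by (rule matrix_norm_inv_nonneg[OF B])
  have qR: "matrix_norm (matrix_inv ?V) ((1 / R) *\<^sub>R S n) = q / R"
    unfolding q_def matrix_norm_inv_factor[OF B] using \<open>R > 0\<close>
    by (simp add: scaleR_vector_matrix_assoc)
  \<comment> \<open>The sum of squares in the exponent is the quadratic form of
    \<open>oful_V\<close> without its regularisation part, which is the shape integrated in
    \<open>gaussian_mixture\<close>.\<close>
  have "exp_process U m R act y x n
      = exp (x \<bullet> ((1 / R) *\<^sub>R S n) - (x \<bullet> (?V *v x) - lam * (norm x)\<^sup>2) / 2)" for x
    unfolding exp_process_def oful_V_quadratic S_def
    by (simp add: sum_subtractf inner_sum_right sum_divide_distrib mult_ac)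
  then have "ennreal (sqrt lam ^ CARD('c) / sqrt (det ?V) * exp ((q / R)\<^sup>2 / 2)) \<le> ennreal (1 / \<delta>)"
    using good gaussian_mixture[OF B \<open>lam > 0\<close>, of "(1 / R) *\<^sub>R S n"] by (simp add: qR)
  then have le: "sqrt lam ^ CARD('c) / sqrt (det ?V) * exp ((q / R)\<^sup>2 / 2) \<le> 1 / \<delta>"
    using \<open>\<delta> > 0\<close> by simp
  then have "ln (sqrt lam ^ CARD('c) / sqrt (det ?V) * exp ((q / R)\<^sup>2 / 2)) \<le> ln (1 / \<delta>)"
    using det \<open>lam > 0\<close> by (intro ln_mono) auto
  then have "real CARD('c) * ln lam / 2 - ln (det ?V) / 2 + (q / R)\<^sup>2 / 2 \<le> ln (1 / \<delta>)"
    using det \<open>lam > 0\<close> by (simp add: ln_mult_pos ln_div ln_realpow ln_sqrt)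
  then have "(q / R)\<^sup>2 \<le> ln (det ?V) - real CARD('c) * ln lam + 2 * ln (1 / \<delta>)" by argo
  then have "q / R \<le> sqrt (ln (det ?V) - real CARD('c) * ln lam + 2 * ln (1 / \<delta>))"
    by (rule real_le_rsqrt)
  then show ?thesis
    unfolding two_ln_radius_argument[OF \<open>lam > 0\<close> \<open>\<delta> > 0\<close>] q_def[symmetric]
    using \<open>R > 0\<close> by (simp add: pos_divide_le_eq mult.commute)
qed

text \<open>The ridge regression solution for the noiseless rewards, centred at \<open>v0\<close>. In contrast to \<open>v0\<close>,
  which only fits the rewards up to the misspecification, it stays in the confidence sets.\<close>

definition oful_target :: "real^'c^'a \<Rightarrow> real^'a \<Rightarrow> real^'c \<Rightarrow> real \<Rightarrow> (nat \<Rightarrow> 'a) \<Rightarrow> nat \<Rightarrow> real^'c" where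
  "oful_target U m v0 lam act n =
     v0 + matrix_inv (oful_V U lam act n) *v (\<Sum>s=1..n. (m $ act s - U $ act s \<bullet> v0) *\<^sub>R U $ act s)"

lemma sum_UNIV_Plus:
  fixes f :: "'a::finite + 'c::finite \<Rightarrow> 'b::comm_monoid_add"
  shows "(\<Sum>r\<in>UNIV. f r) = (\<Sum>a\<in>UNIV. f (Inl a)) + (\<Sum>c\<in>UNIV. f (Inr c))"
  by (subst UNIV_Plus_UNIV[symmetric], subst sum.Plus) simp_all

text \<open>The shift solves a weighted least squares problem for the stacked matrix: row
  \<open>a\<close> has its number of plays as weight and its misspecification as target, the
  identity rows have weight \<open>lam\<close> and target 0. The bound by \<open>alpha\<close> is
  blind to the weights, hence to the history.\<close>

lemma oful_target_dist_le:
  fixes U :: "real^'c^'a"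
  assumes "lam > 0"
  shows "norm (oful_target U m v0 lam act n - v0) \<le> alpha U * norm (m - U *v v0)"
proof -
  define cnt where "cnt a = real (card {s \<in> {1..n}. act s = a})" for a
  define d :: "'a + 'c \<Rightarrow> real" where
    "d r = (case r of Inl a \<Rightarrow> cnt a | Inr c \<Rightarrow> lam)" for r
  define b :: "real^('a + 'c)" where
    "b = (\<chi> r. case r of Inl a \<Rightarrow> m $ a - U $ a \<bullet> v0 | Inr c \<Rightarrow> 0)"
  let ?A = "stack_id U" and ?V = "oful_V U lam act n"
  obtain B where B: "spd_factor ?V B" using oful_V_spd[OF assms] by blast
  \<comment> \<open>Rounds are regrouped by action, turning sums over time into sums over
    rows.\<close>
  have count: "(\<Sum>a\<in>UNIV. cnt a * h a) = (\<Sum>s=1..n. h (act s))" for h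
    using sum_fun_comp[of "{1..n}" UNIV act h] by (simp add: cnt_def)
  have V: "(\<chi> i j. \<Sum>r\<in>UNIV. d r * ?A $ r $ i * ?A $ r $ j) = ?V"
  proof -
    have id: "(\<Sum>c\<in>UNIV. lam * axis c 1 $ i * axis c 1 $ j) = lam * (mat 1 :: real^'c^'c) $ i $ j" for i j
    proof -
      have "(\<Sum>c\<in>UNIV. lam * axis c 1 $ i * axis c 1 $ j) = (\<Sum>c\<in>UNIV. if c = i then (if i = j then lam else 0) else 0)"
        by (rule sum.cong) (auto simp: axis_def)
      then show ?thesis by (simp add: mat_def)
    qed
    have "(\<Sum>r\<in>UNIV. d r * ?A $ r $ i * ?A $ r $ j)
      = (\<Sum>s=1..n. U $ act s $ i * U $ act s $ j) + lam * (mat 1 :: real^'c^'c) $ i $ j" for i j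
      using id[of i j] count[of "\<lambda>a. U $ a $ i * U $ a $ j"]
      by (simp add: sum_UNIV_Plus d_def stack_id_def mult.assoc)
    then show ?thesis by (simp add: oful_V_def vec_eq_iff)
  qed
  have c: "(\<chi> i. \<Sum>r\<in>UNIV. d r * ?A $ r $ i * b $ r)
      = (\<Sum>s=1..n. (m $ act s - U $ act s \<bullet> v0) *\<^sub>R U $ act s)"
  proof -
    have "(\<Sum>r\<in>UNIV. d r * ?A $ r $ i * b $ r) = (\<Sum>s=1..n. U $ act s $ i * (m $ act s - U $ act s \<bullet> v0))" for i
      by (simp add: sum_UNIV_Plus d_def b_def stack_id_def count mult.assoc)
    then show ?thesis by (simp add: vec_eq_iff mult.commute)
  qed
  have b: "norm b = norm (m - U *v v0)"
  proof -
    have "(\<Sum>r\<in>UNIV. (b $ r)\<^sup>2) = (\<Sum>a\<in>UNIV. ((m - U *v v0) $ a)\<^sup>2)"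
      by (simp add: sum_UNIV_Plus b_def matrix_vector_mul_component)
    then show ?thesis by (simp add: norm_vec_def L2_set_def)
  qed
  have "norm (matrix_inv ?V *v (\<chi> i. \<Sum>r\<in>UNIV. d r * ?A $ r $ i * b $ r)) \<le> alpha U * norm b"
    unfolding V[symmetric]
  proof (rule weighted_least_squares_norm_le)
    show "d r \<ge> 0" for r using assms by (simp add: d_def cnt_def split: sum.split)
    show "det (\<chi> i j. \<Sum>r\<in>UNIV. d r * ?A $ r $ i * ?A $ r $ j) > 0"
      unfolding V by (rule spd_factor_det_pos[OF B])
  qed (rule onorm_le_alpha)
  then show ?thesis by (simp add: oful_target_def c b)
qed

text \<open>The misspecification enters target and estimate alike and cancels; the bias from
  \<open>lam\<close> and the noise remain.\<close>

lemma oful_target_error: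
  fixes U :: "real^'c^'a"
  assumes "lam > 0"
  shows "oful_target U m v0 lam act n - oful_estimate U lam act y n
    = matrix_inv (oful_V U lam act n) *v (lam *\<^sub>R v0 - (\<Sum>s=1..n. (y s - m $ act s) *\<^sub>R U $ act s))"
proof -
  let ?V = "oful_V U lam act n"
  let ?e = "\<Sum>s=1..n. (m $ act s - U $ act s \<bullet> v0) *\<^sub>R U $ act s"
  obtain B where B: "spd_factor ?V B" using oful_V_spd[OF assms] by blast
  have "matrix_inv ?V *v (?V *v v0) = v0"
    by (simp add: matrix_vector_mul_assoc matrix_inv_left spd_factor_invertible[OF B])
  then have "oful_target U m v0 lam act n = matrix_inv ?V *v (?V *v v0 + ?e)"
    by (simp add: oful_target_def matrix_vector_right_distrib)
  moreover have "?V *v v0 + ?e - (\<Sum>s=1..n. y s *\<^sub>R U $ act s)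
      = lam *\<^sub>R v0 - (\<Sum>s=1..n. (y s - m $ act s) *\<^sub>R U $ act s)"
    by (simp add: oful_V_mult_vector scaleR_left_diff_distrib sum_subtractf)
  ultimately show ?thesis
    by (simp add: oful_estimate_def matrix_vector_mult_diff_distrib[symmetric])
qed

text \<open>The two summands of \<open>oful_radius\<close> absorb the two remaining errors: the bias
  costs at most \<open>sqrt lam * R_Theta\<close>, the noise at most the logarithmic term.\<close>

lemma oful_target_in_confset:
  fixes U :: "real^'c^'a"
  assumes "lam > 0" "\<delta> > 0" "R > 0" "norm v0 \<le> R_Theta"
    and good: "(\<integral>\<^sup>+ x. ennreal (exp_process U m R act y x n) \<partial>gaussian_prior lam) \<le> ennreal (1 / \<delta>)"
  shows "oful_target U m v0 lam act n \<in> oful_confset U lam R_Theta R \<delta> act y n"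
proof -
  let ?V = "oful_V U lam act n" and ?S = "\<Sum>s=1..n. (y s - m $ act s) *\<^sub>R U $ act s"
  obtain B where B: "spd_factor ?V B" using oful_V_spd[OF assms(1)] by blast
  have "matrix_norm ?V (oful_target U m v0 lam act n - oful_estimate U lam act y n)
      = matrix_norm (matrix_inv ?V) (lam *\<^sub>R v0 - ?S)"
    unfolding oful_target_error[OF assms(1)] by (rule matrix_norm_inv_mult[OF B])
  also have "\<dots> \<le> matrix_norm (matrix_inv ?V) (lam *\<^sub>R v0) + matrix_norm (matrix_inv ?V) ?S"
    unfolding matrix_norm_inv_factor[OF B] vector_matrix_mult_diff_distrib by (rule norm_triangle_ineq4)
  also have "matrix_norm (matrix_inv ?V) (lam *\<^sub>R v0) \<le> norm (lam *\<^sub>R v0) / sqrt lam"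
    by (rule matrix_norm_inv_oful_le[OF assms(1)])
  also have "\<dots> = sqrt lam * norm v0"
    using assms(1) by (simp add: field_simps)
  also have "\<dots> \<le> sqrt lam * R_Theta"
    using assms by (intro mult_left_mono) auto
  finally show ?thesis
    using matrix_norm_inv_noise_le[OF assms(1-3) good]
    unfolding oful_confset_def oful_radius_def by simp
qed

text \<open>Optimism: the value of any arm at \<open>v\<close> is at most the optimistic value of
  the played arm, which exceeds the value of that arm at \<open>v\<close> by at most the diameter of
  the confidence set in its direction.\<close>

lemma oful_gap_le:
  fixes U :: "real^'c^'a"
  assumes "lam > 0" and plays: "oful_plays U lam R_Theta R \<delta> act y" and "t \<ge> 1"
    and v: "v \<in> oful_confset U lam R_Theta R \<delta> act y (t - 1)"
  shows "U $ a \<bullet> v - U $ act t \<bullet> v \<le> 2 * (oful_radius U lam R_Theta R \<delta> act (t - 1)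
     * matrix_norm (matrix_inv (oful_V U lam act (t - 1))) (U $ act t))"
proof -
  let ?V = "oful_V U lam act (t - 1)" and ?C = "oful_confset U lam R_Theta R \<delta> act y (t - 1)"
  let ?D = "oful_radius U lam R_Theta R \<delta> act (t - 1)" and ?v = "oful_estimate U lam act y (t - 1)"
  let ?w = "\<lambda>u. matrix_norm (matrix_inv ?V) u"
  obtain B where B: "spd_factor ?V B" using oful_V_spd[OF assms(1)] by blast
  have up: "u \<bullet> x \<le> u \<bullet> ?v + ?D * ?w u" and low: "u \<bullet> ?v - ?D * ?w u \<le> u \<bullet> x"
    if "x \<in> ?C" for u x
  proof -
    have D: "matrix_norm ?V (x - ?v) \<le> ?D" using that by (simp add: oful_confset_def)
    have sym: "matrix_norm ?V (?v - x) = matrix_norm ?V (x - ?v)"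
      using matrix_norm_scaleR[OF B, of "-1" "x - ?v"] by simp
    have *: "?w u * matrix_norm ?V (x - ?v) \<le> ?D * ?w u"
      using mult_left_mono[OF D matrix_norm_inv_nonneg[OF B]] by (simp add: mult.commute)
    show "u \<bullet> x \<le> u \<bullet> ?v + ?D * ?w u"
      using * inner_le_matrix_norms[OF B, of u "x - ?v"] by (simp add: inner_diff_right)
    show "u \<bullet> ?v - ?D * ?w u \<le> u \<bullet> x"
      using * inner_le_matrix_norms[OF B, of u "?v - x"] unfolding sym inner_diff_right by linarith
  qed
  \<comment> \<open>The estimate \<open>up\<close> bounds the supremum over the confidence set, and
    \<open>v\<close> shows that the set is nonempty; both are needed for suprema of reals.\<close>
  have "U $ a \<bullet> v \<le> (SUP x\<in>?C. U $ a \<bullet> x)"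
    using v up by (intro cSUP_upper bdd_aboveI2) auto
  also have "\<dots> \<le> (SUP x\<in>?C. U $ act t \<bullet> x)"
    using plays \<open>t \<ge> 1\<close> by (auto simp: oful_plays_def is_arg_max_def not_less)
  also have "\<dots> \<le> U $ act t \<bullet> ?v + ?D * ?w (U $ act t)"
    using v up by (intro cSUP_least) auto
  also have "\<dots> \<le> U $ act t \<bullet> v + 2 * (?D * ?w (U $ act t))"
    using low[OF v, of "U $ act t"] by simp
  finally show ?thesis by simp
qed

text \<open>Replacing \<open>v0\<close> by \<open>v\<close> changes a gap by at most
  \<open>norm (U $ a_star - U $ a) * norm (v - v0)\<close>, and the threshold is chosen to make this
  less than half of the gap at \<open>v0\<close>.\<close>

lemma misspecification_margin:
  fixes U :: "real^'c^'a"
  assumes inj: "inj (\<lambda>a. U $ a)" and "a \<noteq> a_star"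
    and thr: "ereal (norm (m - U *v v0)) < misspecification_threshold U a_star v0"
    and v: "norm (v - v0) \<le> alpha U * norm (m - U *v v0)"
  shows "0 < U $ a_star \<bullet> v0 - U $ a \<bullet> v0"
    and "U $ a_star \<bullet> v0 - U $ a \<bullet> v0 \<le> 2 * (U $ a_star \<bullet> v - U $ a \<bullet> v)"
proof -
  let ?u = "U $ a_star - U $ a" and ?e = "norm (m - U *v v0)"
  \<comment> \<open>Distinct features keep the denominator of the threshold nonzero.\<close>
  have "?u \<noteq> 0" using inj \<open>a \<noteq> a_star\<close> by (auto dest: injD)
  then have pos: "0 < alpha U * norm ?u" using alpha_pos[of U] by simp
  have "misspecification_threshold U a_star v0
      \<le> ereal ((U $ a_star \<bullet> v0 - U $ a \<bullet> v0) / (2 * alpha U * norm ?u))"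
    unfolding misspecification_threshold_def using \<open>a \<noteq> a_star\<close> by (intro INF_lower) auto
  with thr have "ereal ?e < ereal ((U $ a_star \<bullet> v0 - U $ a \<bullet> v0) / (2 * alpha U * norm ?u))"
    by (rule less_le_trans)
  then have "?e < (U $ a_star \<bullet> v0 - U $ a \<bullet> v0) / (2 * (alpha U * norm ?u))"
    by (simp add: mult.assoc)
  then have lt: "2 * (?e * (alpha U * norm ?u)) < U $ a_star \<bullet> v0 - U $ a \<bullet> v0"
    using pos by (simp add: pos_less_divide_eq mult_ac)
  moreover have "0 \<le> ?e * (alpha U * norm ?u)" using pos by simp
  ultimately show "0 < U $ a_star \<bullet> v0 - U $ a \<bullet> v0" by linarith
  have "?u \<bullet> (v0 - v) \<le> norm ?u * norm (v - v0)"
    using norm_cauchy_schwarz[of ?u "v0 - v"] by (simp add: norm_minus_commute)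
  also have "\<dots> \<le> ?e * (alpha U * norm ?u)"
    using mult_left_mono[OF v norm_ge_zero[of ?u]] by (simp add: mult_ac)
  finally show "U $ a_star \<bullet> v0 - U $ a \<bullet> v0 \<le> 2 * (U $ a_star \<bullet> v - U $ a \<bullet> v)"
    using lt by (simp add: inner_diff_left inner_diff_right)
qed

lemma gap_ratio_ge_1: "1 \<le> gap_ratio U m a_star v0"
  unfolding gap_ratio_def by (rule Max_ge) auto

lemma gap_ratio_ge:
  assumes "a \<noteq> a_star"
  shows "(m $ a_star - m $ a) / (U $ a_star \<bullet> v0 - U $ a \<bullet> v0) \<le> gap_ratio U m a_star v0"
  unfolding gap_ratio_def using assms by (intro Max_ge) auto

text \<open>A statement about one trajectory; probability enters only through \<open>good\<close>.
  The constant 8 is the product of 2 for the halved gaps, 2 for the confidence width and 2 from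
  summing the widths.\<close>

lemma oful_regret_le:
  fixes U :: "real^'c^'a"
  assumes inj: "inj (\<lambda>a. U $ a)" and "lam > 0" "\<delta> > 0" "R > 0" "R_Theta > 0" "norm v0 \<le> R_Theta" "R_X\<^sup>2 \<le> lam"
    and U: "\<And>a. norm (U $ a) \<le> R_X" and plays: "oful_plays U lam R_Theta R \<delta> act y"
    and thr: "ereal (norm (m - U *v v0)) < misspecification_threshold U a_star v0"
    and "\<delta> < 1"
    and good: "\<And>n. (\<integral>\<^sup>+ x. ennreal (exp_process U m R act y x n) \<partial>gaussian_prior lam) \<le> ennreal (1 / \<delta>)"
  shows "regret m a_star act T \<le> 8 * gap_ratio U m a_star v0
     * sqrt (real T * real CARD('c) * ln (1 + real T * R_X\<^sup>2 / (lam * real CARD('c))))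
     * (sqrt lam * R_Theta + R * sqrt (2 * ln (1 / \<delta>)
         + real CARD('c) * ln (1 + real T * R_X\<^sup>2 / (lam * real CARD('c)))))"
proof -
  define K where "K = real CARD('c) * ln (1 + real T * R_X\<^sup>2 / (lam * real CARD('c)))"
  define D where "D = sqrt lam * R_Theta + R * sqrt (2 * ln (1 / \<delta>) + K)"
  define \<rho> where "\<rho> = gap_ratio U m a_star v0"
  define w where "w t = matrix_norm (matrix_inv (oful_V U lam act (t - 1))) (U $ act t)" for t
  have "\<rho> \<ge> 1" unfolding \<rho>_def by (rule gap_ratio_ge_1)
  have "K \<ge> 0" unfolding K_def using \<open>lam > 0\<close> by (intro mult_nonneg_nonneg ln_ge_zero) auto
  have "ln (1 / \<delta>) \<ge> 0" using \<open>\<delta> > 0\<close> \<open>\<delta> < 1\<close> by (intro ln_ge_zero) auto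
  then have "D \<ge> 0" unfolding D_def
    using \<open>K \<ge> 0\<close> \<open>lam > 0\<close> \<open>R > 0\<close> \<open>R_Theta > 0\<close> by (intro add_nonneg_nonneg mult_nonneg_nonneg) auto
  have w: "w t \<ge> 0" for t
    using oful_V_spd[OF \<open>lam > 0\<close>] matrix_norm_inv_nonneg unfolding w_def by blast
  have inst: "m $ a_star - m $ act t \<le> 4 * \<rho> * D * w t" if t: "t \<in> {1..T}" for t
  proof (cases "act t = a_star")
    case True
    then show ?thesis using w[of t] \<open>D \<ge> 0\<close> \<open>\<rho> \<ge> 1\<close> by simp
  next
    case False
    \<comment> \<open>The comparison vector changes with the round, which is harmless because its
      distance to \<open>v0\<close> has a bound independent of the round.\<close>
    define v where "v = oful_target U m v0 lam act (t - 1)"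
    have v: "v \<in> oful_confset U lam R_Theta R \<delta> act y (t - 1)"
      unfolding v_def by (rule oful_target_in_confset) (use assms in auto)
    have dist: "norm (v - v0) \<le> alpha U * norm (m - U *v v0)"
      unfolding v_def by (rule oful_target_dist_le[OF \<open>lam > 0\<close>])
    let ?g = "U $ a_star \<bullet> v0 - U $ act t \<bullet> v0"
    have g: "0 < ?g" "?g \<le> 2 * (U $ a_star \<bullet> v - U $ act t \<bullet> v)"
      using misspecification_margin[OF inj False thr dist] by blast+
    have "U $ a_star \<bullet> v - U $ act t \<bullet> v \<le> 2 * (oful_radius U lam R_Theta R \<delta> act (t - 1) * w t)"
      unfolding w_def using t by (intro oful_gap_le[OF \<open>lam > 0\<close> plays _ v]) auto
    also have "oful_radius U lam R_Theta R \<delta> act (t - 1) * w t \<le> D * w t"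
      unfolding D_def K_def using t
      by (intro mult_right_mono w oful_radius_le[OF \<open>lam > 0\<close> \<open>\<delta> > 0\<close> \<open>R > 0\<close> U]) auto
    finally have "?g \<le> 4 * (D * w t)" using g(2) by simp
    have "m $ a_star - m $ act t \<le> \<rho> * ?g"
      using gap_ratio_ge[OF False, of m U v0] g(1) by (simp add: pos_divide_le_eq \<rho>_def)
    also have "\<dots> \<le> \<rho> * (4 * (D * w t))"
      using \<open>?g \<le> 4 * (D * w t)\<close> \<open>\<rho> \<ge> 1\<close> by (intro mult_left_mono) auto
    finally show ?thesis by (simp add: mult_ac)
  qed
  have "(\<Sum>t=1..T. w t)\<^sup>2 \<le> (\<Sum>t=1..T. (w t)\<^sup>2) * real (card {1..T})"
    by (rule sum_squared_le_sum_of_squares)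
  also have "\<dots> \<le> (2 * K) * real T"
    using elliptical_potential[OF \<open>lam > 0\<close> \<open>R_X\<^sup>2 \<le> lam\<close> U, where T=T and act=act]
    using \<open>K \<ge> 0\<close> unfolding w_def[symmetric] K_def[symmetric] by (simp add: mult_right_mono)
  \<comment> \<open>The factor 2 of the elliptical potential is rounded up to 4 to leave an integer
    outside the root.\<close>
  also have "\<dots> \<le> (2 * sqrt (real T * K))\<^sup>2"
    using \<open>K \<ge> 0\<close> by (simp add: power_mult_distrib)
  finally have sum_w: "(\<Sum>t=1..T. w t) \<le> 2 * sqrt (real T * K)"
    by (rule power2_le_imp_le) (use \<open>K \<ge> 0\<close> in simp)
  have "regret m a_star act T \<le> (\<Sum>t=1..T. 4 * \<rho> * D * w t)"
    unfolding regret_def by (rule sum_mono) (rule inst)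
  also have "\<dots> = 4 * \<rho> * D * (\<Sum>t=1..T. w t)" by (simp add: sum_distrib_left)
  also have "\<dots> \<le> 4 * \<rho> * D * (2 * sqrt (real T * K))"
    using \<open>D \<ge> 0\<close> \<open>\<rho> \<ge> 1\<close> by (intro mult_left_mono sum_w) auto
  finally show ?thesis by (simp add: D_def K_def \<rho>_def mult_ac)
qed

theorem theorem3:
  fixes M :: "'w measure"
    and U :: "real^'c^'a" and m :: "real^'a" and a_star :: 'a and v0 :: "real^'c"
    and Act :: "nat \<Rightarrow> 'w \<Rightarrow> 'a" and Y \<eta> :: "nat \<Rightarrow> 'w \<Rightarrow> real"
    and lam R_Theta R R_X \<delta> :: real
  assumes "prob_space M"
    and "inj (\<lambda>a. U $ a)"
    and "{a. is_arg_max (\<lambda>a. m $ a) (\<lambda>_. True) a} = {a_star}"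
    and "\<And>t. t \<ge> 1 \<Longrightarrow> Act t \<in> measurable M (count_space UNIV)"
    and "\<And>t. t \<ge> 1 \<Longrightarrow> Y t \<in> borel_measurable M"
    and "\<And>t \<omega>. t \<ge> 1 \<Longrightarrow> \<omega> \<in> space M \<Longrightarrow> Y t \<omega> = m $ Act t \<omega> + \<eta> t \<omega>"
    and "\<And>t. t \<ge> 1 \<Longrightarrow> cond_centered_subgaussian M (past_and_action M Act Y t) R (\<eta> t)"
    and "lam > 0" and "R_Theta > 0" and "R > 0" and "0 < \<delta>" and "\<delta> < 1"
    and "\<And>\<omega>. \<omega> \<in> space M \<Longrightarrow>
           oful_plays U lam R_Theta R \<delta> (\<lambda>t. Act t \<omega>) (\<lambda>t. Y t \<omega>)"
    and "norm v0 \<le> R_Theta"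
    and "lam \<ge> Max {1, R_X\<^sup>2, 1 / (4 * R_Theta\<^sup>2)}"
    and "\<And>a. norm (U $ a) \<le> R_X"
    and "\<And>a. \<bar>m $ a\<bar> \<le> 1"
    and "ereal (norm (m - U *v v0)) < misspecification_threshold U a_star v0"
  shows "measure M {\<omega> \<in> space M. \<forall>T::nat.
           regret m a_star (\<lambda>t. Act t \<omega>) T
             \<le> 8 * gap_ratio U m a_star v0
               * sqrt (real T * real CARD('c) * ln (1 + real T * R_X\<^sup>2 / (lam * real CARD('c))))
               * (sqrt lam * R_Theta
                  + R * sqrt (2 * ln (1 / \<delta>)
                      + real CARD('c) * ln (1 + real T * R_X\<^sup>2 / (lam * real CARD('c)))))}
         \<ge> 1 - \<delta>"
proof -
  interpret prob_space M by fact
  let ?N = "\<lambda>n \<omega>. \<integral>\<^sup>+ x. ennreal (exp_process U m R (\<lambda>s. Act s \<omega>) (\<lambda>s. Y s \<omega>) x n) \<partial>gaussian_prior lam"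
  let ?G = "{\<omega> \<in> space M. \<forall>n. ?N n \<omega> \<le> ennreal (1 / \<delta>)}"
  define r where "r T = 8 * gap_ratio U m a_star v0
    * sqrt (real T * real CARD('c) * ln (1 + real T * R_X\<^sup>2 / (lam * real CARD('c))))
    * (sqrt lam * R_Theta + R * sqrt (2 * ln (1 / \<delta>)
        + real CARD('c) * ln (1 + real T * R_X\<^sup>2 / (lam * real CARD('c)))))" for T :: nat
  let ?H = "{\<omega> \<in> space M. \<forall>T. regret m a_star (\<lambda>t. Act t \<omega>) T \<le> r T}"
  have "Max {1, R_X\<^sup>2, 1 / (4 * R_Theta\<^sup>2)} \<ge> R_X\<^sup>2" by (rule Max_ge) auto
  then have RX: "R_X\<^sup>2 \<le> lam" using assms(15) by linarith
  \<comment> \<open>On the event of the maximal inequality the regret bound holds on every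
    trajectory and for all horizons, so nothing is lost beyond \<open>\<delta>\<close>.\<close>
  have "?G \<subseteq> ?H"
  proof safe
    fix \<omega> T assume \<omega>: "\<omega> \<in> space M" and good: "\<forall>n. ?N n \<omega> \<le> ennreal (1 / \<delta>)"
    show "regret m a_star (\<lambda>t. Act t \<omega>) T \<le> r T"
      unfolding r_def
      by (rule oful_regret_le[OF assms(2) \<open>lam > 0\<close> \<open>0 < \<delta>\<close> \<open>R > 0\<close> \<open>R_Theta > 0\<close> assms(14) RX assms(16)
            assms(13)[OF \<omega>] assms(18) \<open>\<delta> < 1\<close> good[rule_format]])
  qed
  \<comment> \<open>Monotonicity of the measure requires the larger event to be measurable.\<close>
  moreover have "?H \<in> sets M"
  proof (intro sets.sets_Collect_countable_All)
    fix T
    have "(\<lambda>\<omega>. m $ Act t \<omega>) \<in> borel_measurable M" if "t \<in> {1..T}" for t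
      using that by (intro measurable_compose[OF assms(4)]) auto
    then have [measurable]: "(\<lambda>\<omega>. regret m a_star (\<lambda>t. Act t \<omega>) T) \<in> borel_measurable M"
      unfolding regret_def by (intro borel_measurable_sum borel_measurable_diff) auto
    show "{\<omega> \<in> space M. regret m a_star (\<lambda>t. Act t \<omega>) T \<le> r T} \<in> sets M" by measurable
  qed
  ultimately have "measure M ?G \<le> measure M ?H" by (rule finite_measure_mono)
  moreover have "1 - \<delta> \<le> measure M ?G"
    by (rule mixture_maximal_inequality(2)[OF \<open>prob_space M\<close> prob_space_gaussian_prior[OF \<open>lam > 0\<close>]
          sets_gaussian_prior \<open>R > 0\<close> \<open>0 < \<delta>\<close> assms(4-7)])
  ultimately show ?thesis unfolding r_def by linarith
qed

end
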